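(* Let $M$ be a (pointed) subset of an $\mathbb{R}$-tree $T$, with the metric inherited from $T$. Then $\mu\in S_{\mathcal{F}(M)}$ is a Daugavet-point if and only if it is a $\Delta$-point.
   Context: All Banach spaces are real. $B_X$ and $S_X$ denote the closed unit ball and unit sphere of a Banach space $X$. A slice of $B_X$ is a set of the form $S(x^*,\alpha)=\{y\in B_X:\ x^*(y)>\sup x^*(B_X)-\alpha\}$ with $x^*\in X^*$ and $\alpha>0$. A point $x\in S_X$ is a Daugavet-point if $\sup_{y\in S}\|x-y\|=2$ for every slice $S$ of $B_X$, and a $\Delta$-point if $\sup_{y\in S}\|x-y\|=2$ for every slice $S$ of $B_X$ containing $x$. For a metric space $(M,d)$ with a designated origin $0\in M$, $\mathrm{Lip}_0(M)$ is the Banach space of Lipschitz functions $f:M\to\mathbb{R}$ with $f(0)=0$, normed by the best Lipschitz constant. For $x\in M$ let $\delta_x\in \mathrm{Lip}_0(M)^*$, $\delta_x(f)=f(x)$. The Lipschitz-free space is $\mathcal{F}(M)=\overline{\mathrm{span}}\{\delta_x:\ x\in M\}\subset \mathrm{Lip}_0(M)^*$ (its dual is $\mathrm{Lip}_0(M)$). An $\mathbb{R}$-tree is an arc-connected metric space $(T,d)$ such that for any $x\neq y\in T$ there is a unique arc connecting $x$ and $y$, and this arc is isometric to the real segment $[0,d(x,y)]$. *)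

theory Defs
  imports "HOL-Analysis.Analysis"
begin

subsection \<open>\<open>\<real>\<close>-trees\<close>

text \<open>An arc is a set, namely the image of an injective path (\<^const>\<open>arc\<close>); uniqueness of arcs
  is uniqueness of that set, not of its parametrization.\<close>

definition arc_between :: "'t::metric_space set \<Rightarrow> 't \<Rightarrow> 't \<Rightarrow> 't set \<Rightarrow> bool"
  where "arc_between T x y A \<longleftrightarrow>
    A \<subseteq> T \<and> (\<exists>g. arc g \<and> pathstart g = x \<and> pathfinish g = y \<and> path_image g = A)"

definition isometric_to_segment :: "'t::metric_space set \<Rightarrow> real \<Rightarrow> bool"
  where "isometric_to_segment A l \<longleftrightarrow>
    (\<exists>h::real \<Rightarrow> 't. h ` {0..l} = A \<and> (\<forall>s\<in>{0..l}. \<forall>t\<in>{0..l}. dist (h s) (h t) = dist s t))"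

definition real_tree :: "'t::metric_space set \<Rightarrow> bool"
  where "real_tree T \<longleftrightarrow>
    (\<forall>x\<in>T. \<forall>y\<in>T. x \<noteq> y \<longrightarrow>
      (\<exists>!A. arc_between T x y A) \<and>
      (\<forall>A. arc_between T x y A \<longrightarrow> isometric_to_segment A (dist x y)))"


subsection \<open>Daugavet-points and \<open>\<Delta>\<close>-points\<close>

definition slice :: "('b::real_normed_vector \<Rightarrow>\<^sub>L real) \<Rightarrow> real \<Rightarrow> 'b set"
  where "slice f \<alpha> = {y \<in> cball 0 1. blinfun_apply f y > (SUP z\<in>cball 0 1. blinfun_apply f z) - \<alpha>}"

definition daugavet_point :: "'b::real_normed_vector \<Rightarrow> bool"
  where "daugavet_point x \<longleftrightarrow> x \<in> sphere 0 1 \<and>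
    (\<forall>f \<alpha>. \<alpha> > 0 \<longrightarrow> (SUP y\<in>slice f \<alpha>. norm (x - y)) = 2)"

definition delta_point :: "'b::real_normed_vector \<Rightarrow> bool"
  where "delta_point x \<longleftrightarrow> x \<in> sphere 0 1 \<and>
    (\<forall>f \<alpha>. \<alpha> > 0 \<and> x \<in> slice f \<alpha> \<longrightarrow> (SUP y\<in>slice f \<alpha>. norm (x - y)) = 2)"


subsection \<open>The space of Lipschitz functions vanishing at the origin\<close>

text \<open>A pointed metric space is a type of sort \<^class>\<open>metric_space\<close> and \<^class>\<open>zero\<close>: the element
  \<open>0\<close> is the designated origin, and no algebraic structure is assumed.\<close>

typedef (overloaded) ('a::"{metric_space,zero}") lip0 =
  "{f :: 'a \<Rightarrow> real. f 0 = 0 \<and> (\<exists>L. L-lipschitz_on UNIV f)}"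
  morphisms lip0_apply Lip0
  by (rule exI[of _ "\<lambda>_. 0"]) (auto intro!: exI[of _ 0] lipschitz_onI)

setup_lifting type_definition_lip0

lemma lip0_eqI: "(\<And>x. lip0_apply f x = lip0_apply g x) \<Longrightarrow> f = g"
  by transfer auto

lemma lip0_apply_origin [simp]: "lip0_apply f 0 = 0"
  by transfer auto

instantiation lip0 :: ("{metric_space,zero}") real_vector
begin

lift_definition zero_lip0 :: "'a lip0" is "\<lambda>_. 0"
  by (auto intro!: exI[of _ 0] lipschitz_onI)

lift_definition plus_lip0 :: "'a lip0 \<Rightarrow> 'a lip0 \<Rightarrow> 'a lip0" is "\<lambda>f g x. f x + g x"
  by (auto intro: lipschitz_intros)

lift_definition uminus_lip0 :: "'a lip0 \<Rightarrow> 'a lip0" is "\<lambda>f x. - f x"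
  by (auto simp: lipschitz_on_def dist_real_def abs_minus_commute)

lift_definition minus_lip0 :: "'a lip0 \<Rightarrow> 'a lip0 \<Rightarrow> 'a lip0" is "\<lambda>f g x. f x - g x"
  by (auto intro: lipschitz_intros)

lift_definition scaleR_lip0 :: "real \<Rightarrow> 'a lip0 \<Rightarrow> 'a lip0" is "\<lambda>r f x. r *\<^sub>R f x"
  by (auto intro: lipschitz_on_cmult_real)

instance
  by standard (transfer; simp add: fun_eq_iff algebra_simps)+

end

lemmas lip0_apply_simps [simp] =
  zero_lip0.rep_eq plus_lip0.rep_eq uminus_lip0.rep_eq minus_lip0.rep_eq scaleR_lip0.rep_eq

instantiation lip0 :: ("{metric_space,zero}") real_normed_vector
begin

definition norm_lip0 :: "'a lip0 \<Rightarrow> real"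
  where "norm_lip0 f = Inf {L. L-lipschitz_on UNIV (lip0_apply f)}"

definition dist_lip0 :: "'a lip0 \<Rightarrow> 'a lip0 \<Rightarrow> real"
  where "dist_lip0 f g = norm (f - g)"

definition sgn_lip0 :: "'a lip0 \<Rightarrow> 'a lip0"
  where "sgn_lip0 f = f /\<^sub>R norm f"

definition uniformity_lip0 :: "('a lip0 \<times> 'a lip0) filter"
  where "uniformity_lip0 = (INF e\<in>{0<..}. principal {(x, y). dist x y < e})"

definition open_lip0 :: "'a lip0 set \<Rightarrow> bool"
  where "open_lip0 S = (\<forall>x\<in>S. \<forall>\<^sub>F (x', y) in uniformity. x' = x \<longrightarrow> y \<in> S)"

lemma lip0_norm_le:
  assumes "\<And>x y. \<bar>lip0_apply f x - lip0_apply f y\<bar> \<le> L * dist x y" and "0 \<le> L"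
  shows "norm f \<le> L"
  unfolding norm_lip0_def using assms
  by (intro cInf_lower)
    (auto simp: lipschitz_on_def dist_real_def intro!: bdd_belowI[of _ 0])

lemma lip0_norm_nonneg: "0 \<le> norm (f :: 'a lip0)"
proof -
  obtain L where "L-lipschitz_on UNIV (lip0_apply f)"
    using lip0_apply[of f] by auto
  then show ?thesis
    unfolding norm_lip0_def by (intro cInf_greatest) (auto simp: lipschitz_on_def)
qed

lemma lip0_diff_le: "\<bar>lip0_apply f x - lip0_apply f y\<bar> \<le> norm f * dist x y"
proof (cases "x = y")
  case False
  obtain L0 where L0: "L0-lipschitz_on UNIV (lip0_apply f)"
    using lip0_apply[of f] by auto
  have "\<bar>lip0_apply f x - lip0_apply f y\<bar> / dist x y \<le> norm f"
    unfolding norm_lip0_def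
  proof (rule cInf_greatest)
    fix L assume "L \<in> {L. L-lipschitz_on UNIV (lip0_apply f)}"
    then have "\<bar>lip0_apply f x - lip0_apply f y\<bar> \<le> L * dist x y"
      by (auto simp: lipschitz_on_def dist_real_def)
    then show "\<bar>lip0_apply f x - lip0_apply f y\<bar> / dist x y \<le> L"
      using False by (simp add: divide_le_eq)
  qed (use L0 in auto)
  then show ?thesis
    using False by (simp add: divide_le_eq)
qed simp

lemma lip0_norm_scaleR_le: "norm (a *\<^sub>R f) \<le> \<bar>a\<bar> * norm (f :: 'a lip0)"
proof (rule lip0_norm_le)
  fix x y
  have "\<bar>a * lip0_apply f x - a * lip0_apply f y\<bar> = \<bar>a\<bar> * \<bar>lip0_apply f x - lip0_apply f y\<bar>"
    by (metis abs_mult right_diff_distrib)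
  also have "\<dots> \<le> \<bar>a\<bar> * (norm f * dist x y)"
    by (intro mult_left_mono lip0_diff_le) auto
  finally show "\<bar>lip0_apply (a *\<^sub>R f) x - lip0_apply (a *\<^sub>R f) y\<bar> \<le> \<bar>a\<bar> * norm f * dist x y"
    by (simp add: mult.assoc)
qed (simp add: lip0_norm_nonneg)

instance
proof
  fix a :: real and f g :: "'a lip0"
  show "dist f g = norm (f - g)"
    by (rule dist_lip0_def)
  show "sgn f = f /\<^sub>R norm f"
    by (rule sgn_lip0_def)
  show "uniformity = (INF e\<in>{0<..}. principal {(x, y :: 'a lip0). dist x y < e})"
    by (rule uniformity_lip0_def)
  show "open S = (\<forall>x\<in>S. \<forall>\<^sub>F (x', y) in uniformity. x' = x \<longrightarrow> y \<in> S)" for S :: "'a lip0 set"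
    by (rule open_lip0_def)
  show "norm f = 0 \<longleftrightarrow> f = 0"
  proof
    assume 0: "norm f = 0"
    show "f = 0"
    proof (rule lip0_eqI)
      show "lip0_apply f x = lip0_apply 0 x" for x
        using lip0_diff_le[of f x 0] 0 by simp
    qed
  next
    assume "f = 0"
    then show "norm f = 0"
      using lip0_norm_le[of f 0] lip0_norm_nonneg[of f] by simp
  qed
  show "norm (f + g) \<le> norm f + norm g"
  proof (rule lip0_norm_le)
    fix x y
    show "\<bar>lip0_apply (f + g) x - lip0_apply (f + g) y\<bar> \<le> (norm f + norm g) * dist x y"
      using lip0_diff_le[of f x y] lip0_diff_le[of g x y] by (simp add: distrib_right)
  qed (simp add: lip0_norm_nonneg)
  show "norm (a *\<^sub>R f) = \<bar>a\<bar> * norm f"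
  proof (cases "a = 0")
    case True
    then show ?thesis
      using lip0_norm_scaleR_le[of a f] lip0_norm_nonneg[of "a *\<^sub>R f"] by simp
  next
    case False
    have "norm f \<le> \<bar>inverse a\<bar> * norm (a *\<^sub>R f)"
      using lip0_norm_scaleR_le[of "inverse a" "a *\<^sub>R f"] False by simp
    then have "\<bar>a\<bar> * norm f \<le> norm (a *\<^sub>R f)"
      using False by (simp add: field_simps)
    then show ?thesis
      using lip0_norm_scaleR_le[of a f] by simp
  qed
qed

end

instance lip0 :: ("{metric_space,zero}") banach
proof
  fix X :: "nat \<Rightarrow> 'a lip0"
  assume X: "Cauchy X"
  have "Cauchy (\<lambda>n. lip0_apply (X n) x)" for x
  proof (rule metric_CauchyI)
    fix e :: real assume "0 < e"
    define d where "d = dist x 0 + 1"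
    have d: "0 < d" by (simp add: d_def add_nonneg_pos)
    obtain N where N: "\<And>m n. m \<ge> N \<Longrightarrow> n \<ge> N \<Longrightarrow> norm (X m - X n) < e / d"
      using CauchyD[OF X divide_pos_pos[OF \<open>0 < e\<close> d]] by blast
    have "dist (lip0_apply (X m) x) (lip0_apply (X n) x) < e" if "m \<ge> N" "n \<ge> N" for m n
    proof -
      have "dist (lip0_apply (X m) x) (lip0_apply (X n) x) \<le> norm (X m - X n) * dist x 0"
        using lip0_diff_le[of "X m - X n" x 0] by (simp add: dist_real_def)
      also have "\<dots> \<le> norm (X m - X n) * d"
        by (intro mult_left_mono) (auto simp: d_def)
      also have "\<dots> < e"
        using N[OF that] d by (simp add: field_simps)
      finally show ?thesis .
    qed
    then show "\<exists>M. \<forall>m\<ge>M. \<forall>n\<ge>M. dist (lip0_apply (X m) x) (lip0_apply (X n) x) < e"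
      by blast
  qed
  then obtain l where l: "\<And>x. (\<lambda>n. lip0_apply (X n) x) \<longlonglongrightarrow> l x"
    unfolding Cauchy_convergent_iff convergent_def by metis
  have tail: "\<bar>(lip0_apply (X n) x - l x) - (lip0_apply (X n) y - l y)\<bar> \<le> e * dist x y"
    if N: "\<And>m. m \<ge> N \<Longrightarrow> norm (X n - X m) \<le> e" for n N e x y
  proof (rule tendsto_upperbound)
    show "(\<lambda>m. \<bar>(lip0_apply (X n) x - lip0_apply (X m) x)
        - (lip0_apply (X n) y - lip0_apply (X m) y)\<bar>)
      \<longlonglongrightarrow> \<bar>(lip0_apply (X n) x - l x) - (lip0_apply (X n) y - l y)\<bar>"
      by (intro tendsto_intros l)
    show "\<forall>\<^sub>F m in sequentially. \<bar>(lip0_apply (X n) x - lip0_apply (X m) x)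
        - (lip0_apply (X n) y - lip0_apply (X m) y)\<bar> \<le> e * dist x y"
      using eventually_ge_at_top[of N]
    proof eventually_elim
      case (elim m)
      show ?case
        using lip0_diff_le[of "X n - X m" x y] mult_right_mono[OF N[OF elim], of "dist x y"]
        by simp
    qed
  qed simp
  have "l 0 = 0"
    using l[of 0] by (simp add: LIMSEQ_const_iff)
  moreover have "\<exists>L. L-lipschitz_on UNIV l"
  proof -
    obtain N where N: "\<And>m n. m \<ge> N \<Longrightarrow> n \<ge> N \<Longrightarrow> norm (X m - X n) < 1"
      using CauchyD[OF X, of 1] by auto
    have "\<bar>l x - l y\<bar> \<le> (norm (X N) + 1) * dist x y" for x y
    proof -
      have "\<bar>(lip0_apply (X N) x - l x) - (lip0_apply (X N) y - l y)\<bar> \<le> 1 * dist x y"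
        by (rule tail[of N]) (simp add: N less_imp_le)
      then show ?thesis
        using lip0_diff_le[of "X N" x y] by (simp add: distrib_right)
    qed
    then show ?thesis
      by (auto intro!: exI[of _ "norm (X N) + 1"] lipschitz_onI simp: dist_real_def)
  qed
  ultimately have lift: "lip0_apply (Lip0 l) = l"
    by (simp add: Lip0_inverse)
  have "X \<longlonglongrightarrow> Lip0 l"
  proof (rule LIMSEQ_I)
    fix r :: real assume "0 < r"
    then obtain N where N: "\<And>m n. m \<ge> N \<Longrightarrow> n \<ge> N \<Longrightarrow> norm (X m - X n) < r / 2"
      using CauchyD[OF X, of "r / 2"] by auto
    have "norm (X n - Lip0 l) \<le> r / 2" if "n \<ge> N" for n
    proof (rule lip0_norm_le)
      fix x y
      have "\<bar>(lip0_apply (X n) x - l x) - (lip0_apply (X n) y - l y)\<bar> \<le> r / 2 * dist x y"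
        by (rule tail[of N]) (use N that in \<open>simp add: less_imp_le\<close>)
      then show "\<bar>lip0_apply (X n - Lip0 l) x - lip0_apply (X n - Lip0 l) y\<bar> \<le> r / 2 * dist x y"
        by (simp add: lift)
    qed (use \<open>0 < r\<close> in simp)
    moreover have "r / 2 < r"
      using \<open>0 < r\<close> by simp
    ultimately show "\<exists>N. \<forall>n\<ge>N. norm (X n - Lip0 l) < r"
      by (meson order_le_less_trans)
  qed
  then show "convergent X"
    by (rule convergentI)
qed


subsection \<open>The Lipschitz-free space\<close>

lift_definition lip_delta :: "'a::{metric_space,zero} \<Rightarrow> 'a lip0 \<Rightarrow>\<^sub>L real"
  is "\<lambda>x f. lip0_apply f x"
proof
  fix x :: 'a
  show "\<exists>K. \<forall>f. norm (lip0_apply f x) \<le> norm f * K"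
    using lip0_diff_le[of _ x 0] by (auto intro!: exI[of _ "dist x 0"])
qed auto

typedef (overloaded) ('a::"{metric_space,zero}") lipfree =
  "closure (span (range (lip_delta :: 'a \<Rightarrow> 'a lip0 \<Rightarrow>\<^sub>L real)))"
  morphisms lipfree_functional Lipfree
  using closure_subset span_zero by blast

setup_lifting type_definition_lipfree

lemma subspace_closure_real_normed_vector:
  fixes S :: "'b::real_normed_vector set"
  assumes "subspace S"
  shows "subspace (closure S)"
proof (rule subspaceI)
  show "0 \<in> closure S"
    using subspace_0[OF assms] closure_subset by blast
next
  fix x y assume "x \<in> closure S" "y \<in> closure S"
  then obtain u v where uv: "\<And>n. u n \<in> S" "u \<longlonglongrightarrow> x" "\<And>n. v n \<in> S" "v \<longlonglongrightarrow> y"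
    unfolding closure_sequential by blast
  have "(\<lambda>n. u n + v n) \<longlonglongrightarrow> x + y"
    by (intro tendsto_add uv)
  moreover have "\<forall>n. u n + v n \<in> S"
    using uv subspace_add[OF assms] by blast
  ultimately show "x + y \<in> closure S"
    unfolding closure_sequential by (intro exI[of _ "\<lambda>n. u n + v n"] conjI)
next
  fix c :: real and x assume "x \<in> closure S"
  then obtain u where u: "\<And>n. u n \<in> S" "u \<longlonglongrightarrow> x"
    unfolding closure_sequential by blast
  have "(\<lambda>n. c *\<^sub>R u n) \<longlonglongrightarrow> c *\<^sub>R x"
    by (intro tendsto_scaleR tendsto_const u)
  moreover have "\<forall>n. c *\<^sub>R u n \<in> S"
    using u subspace_scale[OF assms] by blast
  ultimately show "c *\<^sub>R x \<in> closure S"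
    unfolding closure_sequential by (intro exI[of _ "\<lambda>n. c *\<^sub>R u n"] conjI)
qed

lemma subspace_lipfree:
  "subspace (closure (span (range (lip_delta :: 'a::{metric_space,zero} \<Rightarrow> _))))"
  by (intro subspace_closure_real_normed_vector subspace_span)

text \<open>All operations and the norm are those of the dual of \<open>'a lip0\<close>.\<close>

instantiation lipfree :: ("{metric_space,zero}") real_vector
begin

lift_definition zero_lipfree :: "'a lipfree" is 0
  by (rule subspace_0[OF subspace_lipfree])

lift_definition plus_lipfree :: "'a lipfree \<Rightarrow> 'a lipfree \<Rightarrow> 'a lipfree" is "(+)"
  by (rule subspace_add[OF subspace_lipfree])

lift_definition uminus_lipfree :: "'a lipfree \<Rightarrow> 'a lipfree" is uminus
  by (rule subspace_neg[OF subspace_lipfree])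

lift_definition minus_lipfree :: "'a lipfree \<Rightarrow> 'a lipfree \<Rightarrow> 'a lipfree" is "(-)"
  by (rule subspace_diff[OF subspace_lipfree])

lift_definition scaleR_lipfree :: "real \<Rightarrow> 'a lipfree \<Rightarrow> 'a lipfree" is scaleR
  by (rule subspace_scale[OF subspace_lipfree])

instance
  by standard (transfer; simp add: algebra_simps)+

end

instantiation lipfree :: ("{metric_space,zero}") real_normed_vector
begin

lift_definition norm_lipfree :: "'a lipfree \<Rightarrow> real" is norm .

lift_definition dist_lipfree :: "'a lipfree \<Rightarrow> 'a lipfree \<Rightarrow> real" is dist .

definition sgn_lipfree :: "'a lipfree \<Rightarrow> 'a lipfree"
  where "sgn_lipfree f = f /\<^sub>R norm f"

definition uniformity_lipfree :: "('a lipfree \<times> 'a lipfree) filter"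
  where "uniformity_lipfree = (INF e\<in>{0<..}. principal {(x, y). dist x y < e})"

definition open_lipfree :: "'a lipfree set \<Rightarrow> bool"
  where "open_lipfree S = (\<forall>x\<in>S. \<forall>\<^sub>F (x', y) in uniformity. x' = x \<longrightarrow> y \<in> S)"

instance
proof
  fix a :: real and f g :: "'a lipfree"
  show "dist f g = norm (f - g)" by transfer (rule dist_norm)
  show "sgn f = f /\<^sub>R norm f" by (rule sgn_lipfree_def)
  show "uniformity = (INF e\<in>{0<..}. principal {(x, y :: 'a lipfree). dist x y < e})"
    by (rule uniformity_lipfree_def)
  show "open S = (\<forall>x\<in>S. \<forall>\<^sub>F (x', y) in uniformity. x' = x \<longrightarrow> y \<in> S)"
    for S :: "'a lipfree set"
    by (rule open_lipfree_def)
  show "norm f = 0 \<longleftrightarrow> f = 0" by transfer simp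
  show "norm (f + g) \<le> norm f + norm g" by transfer (rule norm_triangle_ineq)
  show "norm (a *\<^sub>R f) = \<bar>a\<bar> * norm f" by transfer simp
qed

end

instance lipfree :: ("{metric_space,zero}") banach
proof
  fix X :: "nat \<Rightarrow> 'a lipfree"
  assume "Cauchy X"
  then have "Cauchy (\<lambda>n. lipfree_functional (X n))"
    by (simp add: Cauchy_def dist_lipfree.rep_eq)
  then obtain l where l: "(\<lambda>n. lipfree_functional (X n)) \<longlonglongrightarrow> l"
    unfolding Cauchy_convergent_iff convergent_def by blast
  have "l \<in> closure (span (range (lip_delta :: 'a \<Rightarrow> _)))"
    by (rule Lim_in_closed_set[OF closed_closure _ _ l]) (simp_all add: lipfree_functional)
  then have "lipfree_functional (Lipfree l) = l"
    by (rule Lipfree_inverse)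
  with l have "X \<longlonglongrightarrow> Lipfree l"
    by (simp add: lim_sequentially dist_lipfree.rep_eq)
  then show "convergent X"
    by (rule convergentI)
qed

end

theory Submission
  imports Defs
begin

text \<open>
  Every Daugavet-point is a \<open>\<Delta>\<close>-point, so the work is to show that a \<open>\<mu>\<close> of norm \<open>1\<close> which is not a
  Daugavet-point is not a \<open>\<Delta>\<close>-point. An element of the free space of a subset of a tree is best
  imagined as a function on the tree, its value at a point being the mass on the far side of that
  point; the norm is the \<open>L\<^sup>1\<close>-norm, and the molecule of two points is the normalized indicator of the
  segment between them. Two elements of norm \<open>1\<close> have distance less than \<open>2\<close> if and only if they have
  the same sign on a set of positive length.

  Suppose that the distances of some slice from \<open>\<mu>\<close> are bounded away from \<open>2\<close>, and let \<open>F\<close> be the Lipschitz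
  function defining it. Molecules along which \<open>F\<close> is steep belong to the slice. They cannot be
  arbitrarily short, because a short molecule is almost disjoint from \<open>\<mu>\<close>
  (\<open>short_molecules_far\<close>). A shortest pair on which \<open>F\<close> is steep has no point of the space between its
  members, as such a point would divide the pair into two shorter ones, one of them as steep
  (\<open>steep_gap_exists\<close>). So there is a segment whose interior keeps away from the space and
  whose molecule overlaps with \<open>\<mu>\<close> (\<open>overlap_with_close_molecule\<close>).

  In such a gap elements of the free space cannot concentrate: a function that varies only with the
  projection to the inner part of the gap has a Lipschitz constant controlled by its oscillation
  (\<open>mono_lipschitz\<close>). Approximation by finitely supported elements therefore works uniformly there,
  and \<open>\<mu>\<close> is bounded below by some \<open>\<kappa> > 0\<close> on a whole piece of the gap (\<open>positive_subsegment\<close>). Let \<open>g\<close>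
  be the mean of an almost norming function of \<open>\<mu>\<close> and of the coordinate on this piece. The pairing
  of \<open>\<mu>\<close> with \<open>g\<close> exceeds \<open>1 / 2\<close> by some margin, which a molecule can do only by spending a fixed
  proportion of its length on the piece, where it overlaps with \<open>\<mu>\<close> by a fixed amount (\<open>crossing_molecule_estimate\<close>). Hence
  a slice defined by \<open>g\<close> contains \<open>\<mu>\<close>, and its distances from \<open>\<mu>\<close> are bounded away from \<open>2\<close>
  (\<open>slice_bound_from_molecules\<close>, \<open>not_delta_point_if_positive\<close>).

  The \<open>L\<^sup>1\<close>-picture enters only through one operation: a \<open>1\<close>-Lipschitz function on the tree may be
  given any slope between \<open>-1\<close> and \<open>1\<close> on a part of a geodesic and remains \<open>1\<close>-Lipschitz
  (\<open>reslope_lipschitz\<close>).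
\<close>

section \<open>Duality between Lipschitz functions and the free space\<close>

text \<open>Subtracting the value at the origin makes the pairing depend on \<open>\<phi>\<close> only up to constants, so that
  functions need not be normalized. It is meaningful for Lipschitz \<open>\<phi>\<close> only.\<close>

definition pairing :: "'m::{metric_space,zero} lipfree \<Rightarrow> ('m \<Rightarrow> real) \<Rightarrow> real"
  where "pairing \<mu> \<phi> = lipfree_functional \<mu> (Lip0 (\<lambda>x. \<phi> x - \<phi> 0))"

definition dirac :: "'m::{metric_space,zero} \<Rightarrow> 'm lipfree"
  where "dirac x = Lipfree (lip_delta x)"

definition molecule :: "'m::{metric_space,zero} \<Rightarrow> 'm \<Rightarrow> 'm lipfree"
  where "molecule u v = (dirac v - dirac u) /\<^sub>R dist u v"

lemma lipschitz_real_iff: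
  fixes \<phi> :: "'m::metric_space \<Rightarrow> real"
  shows "L-lipschitz_on UNIV \<phi> \<longleftrightarrow> 0 \<le> L \<and> (\<forall>x y. \<phi> x - \<phi> y \<le> L * dist x y)"
proof -
  have "\<bar>\<phi> x - \<phi> y\<bar> \<le> L * dist x y" if "\<forall>x y. \<phi> x - \<phi> y \<le> L * dist x y" for x y
    using that[rule_format, of x y] that[rule_format, of y x] by (simp add: dist_commute abs_le_iff)
  then show ?thesis
    unfolding lipschitz_on_def dist_real_def by (force simp: abs_le_iff)
qed

lemma lip0_apply_Lip0:
  assumes "L-lipschitz_on UNIV \<phi>"
  shows "lip0_apply (Lip0 (\<lambda>x. \<phi> x - \<phi> 0)) = (\<lambda>x. \<phi> x - \<phi> 0)"
proof (rule Lip0_inverse)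
  have "L-lipschitz_on UNIV (\<lambda>x. \<phi> x - \<phi> 0)"
    using assms by (simp add: lipschitz_real_iff)
  then show "(\<lambda>x. \<phi> x - \<phi> 0) \<in> {f. f 0 = 0 \<and> (\<exists>L. L-lipschitz_on UNIV f)}"
    by auto
qed

lemma norm_Lip0_le:
  assumes "L-lipschitz_on UNIV \<phi>"
  shows "norm (Lip0 (\<lambda>x. \<phi> x - \<phi> 0)) \<le> L"
  using assms lipschitz_onD[OF assms] lipschitz_on_nonneg[OF assms]
  by (intro lip0_norm_le) (auto simp: lip0_apply_Lip0[OF assms] dist_real_def)

lemma pairing_cong_const:
  assumes "\<And>x. \<phi> x = \<psi> x + c"
  shows "pairing \<mu> \<phi> = pairing \<mu> \<psi>"
  by (simp add: pairing_def assms)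

lemma pairing_const:
  fixes \<mu> :: "'m::{metric_space,zero} lipfree"
  shows "pairing \<mu> (\<lambda>_. c) = 0"
proof -
  have "Lip0 (\<lambda>_::'m. 0) = 0"
    by (simp add: zero_lip0_def)
  then show ?thesis
    by (simp add: pairing_def blinfun.zero_right)
qed

lemma pairing_add:
  assumes "K-lipschitz_on UNIV \<phi>" "L-lipschitz_on UNIV \<psi>"
  shows "pairing \<mu> (\<lambda>x. \<phi> x + \<psi> x) = pairing \<mu> \<phi> + pairing \<mu> \<psi>"
proof -
  note lip = lip0_apply_Lip0[OF assms(1)] lip0_apply_Lip0[OF assms(2)]
    lip0_apply_Lip0[OF lipschitz_on_add[OF assms]]
  have "Lip0 (\<lambda>x. (\<phi> x + \<psi> x) - (\<phi> 0 + \<psi> 0)) = Lip0 (\<lambda>x. \<phi> x - \<phi> 0) + Lip0 (\<lambda>x. \<psi> x - \<psi> 0)"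
    by (rule lip0_eqI) (simp add: lip)
  then show ?thesis
    by (simp add: pairing_def blinfun.add_right)
qed

lemma pairing_cmult:
  assumes "L-lipschitz_on UNIV \<phi>"
  shows "pairing \<mu> (\<lambda>x. c * \<phi> x) = c * pairing \<mu> \<phi>"
proof -
  have "Lip0 (\<lambda>x. c * \<phi> x - c * \<phi> 0) = c *\<^sub>R Lip0 (\<lambda>x. \<phi> x - \<phi> 0)"
    by (rule lip0_eqI)
      (simp add: lip0_apply_Lip0[OF assms] lip0_apply_Lip0[OF lipschitz_on_cmult_real[OF assms]]
        algebra_simps)
  then show ?thesis
    by (simp add: pairing_def blinfun.scaleR_right)
qed

lemma pairing_diff:
  assumes "K-lipschitz_on UNIV \<phi>" "L-lipschitz_on UNIV \<psi>"
  shows "pairing \<mu> (\<lambda>x. \<phi> x - \<psi> x) = pairing \<mu> \<phi> - pairing \<mu> \<psi>"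
  using pairing_add[OF assms(1) lipschitz_on_cmult_real[OF assms(2), of "-1"]]
    pairing_cmult[OF assms(2), of \<mu> "-1"] by simp

lemma abs_pairing_le:
  assumes "L-lipschitz_on UNIV \<phi>"
  shows "\<bar>pairing \<mu> \<phi>\<bar> \<le> norm \<mu> * L"
proof -
  have "\<bar>pairing \<mu> \<phi>\<bar> \<le> norm \<mu> * norm (Lip0 (\<lambda>x. \<phi> x - \<phi> 0))"
    using norm_blinfun[of "lipfree_functional \<mu>"]
    by (simp add: pairing_def norm_lipfree.rep_eq)
  also have "\<dots> \<le> norm \<mu> * L"
    by (intro mult_left_mono norm_Lip0_le assms) auto
  finally show ?thesis .
qed

lemma lipfree_norm_le:
  assumes "\<And>\<phi>. 1-lipschitz_on UNIV \<phi> \<Longrightarrow> pairing \<mu> \<phi> \<le> C"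
  shows "norm \<mu> \<le> C"
proof -
  have "pairing \<mu> (\<lambda>x. 0) = 0"
    using pairing_cmult[OF lipschitz_on_constant[of UNIV 0], of \<mu> 0] by simp
  moreover have "1-lipschitz_on UNIV (\<lambda>x::'a. 0::real)"
    by (auto simp: lipschitz_real_iff)
  ultimately have C: "0 \<le> C"
    using assms by fastforce
  show ?thesis
    unfolding norm_lipfree.rep_eq
  proof (rule norm_blinfun_bound[OF C])
    fix f :: "'a lip0"
    have bound: "blinfun_apply (lipfree_functional \<mu>) f \<le> C * norm f" for f
    proof (cases "f = 0")
      case True
      then show ?thesis by simp
    next
      case False
      define \<phi> where "\<phi> = (\<lambda>x. lip0_apply f x / norm f)"
      have "1-lipschitz_on UNIV \<phi>"
        using lip0_diff_le[of f] False
        by (auto simp: lipschitz_real_iff \<phi>_def diff_divide_distrib[symmetric] divide_le_eq abs_le_iff mult.commute)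
      moreover have "Lip0 (\<lambda>x. \<phi> x - \<phi> 0) = f /\<^sub>R norm f"
        by (rule lip0_eqI) (simp add: lip0_apply_Lip0[OF calculation], simp add: \<phi>_def divide_inverse)
      ultimately have "blinfun_apply (lipfree_functional \<mu>) f / norm f \<le> C"
        using assms[of \<phi>] by (simp add: pairing_def blinfun.scaleR_right divide_inverse mult.commute)
      then show ?thesis
        using False by (simp add: divide_le_eq)
    qed
    show "norm (blinfun_apply (lipfree_functional \<mu>) f) \<le> C * norm f"
      using bound[of f] bound[of "- f"] by (simp add: blinfun.minus_right abs_le_iff)
  qed
qed

lemma almost_norming:
  assumes "c < norm \<mu>"
  obtains \<phi> where "1-lipschitz_on UNIV \<phi>" "c < pairing \<mu> \<phi>"
  using lipfree_norm_le[of \<mu> c] assms by (meson not_le)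

lemma pairing_le_norm:
  assumes "1-lipschitz_on UNIV \<phi>"
  shows "pairing \<mu> \<phi> \<le> norm \<mu>"
  using abs_pairing_le[OF assms, of \<mu>] by simp

lemma pairing_simps_left:
  "pairing (\<mu> + \<nu>) \<phi> = pairing \<mu> \<phi> + pairing \<nu> \<phi>"
  "pairing (\<mu> - \<nu>) \<phi> = pairing \<mu> \<phi> - pairing \<nu> \<phi>"
  "pairing (c *\<^sub>R \<mu>) \<phi> = c * pairing \<mu> \<phi>"
  "pairing 0 \<phi> = 0"
  by (simp_all add: pairing_def plus_lipfree.rep_eq minus_lipfree.rep_eq scaleR_lipfree.rep_eq
      zero_lipfree.rep_eq blinfun.add_left blinfun.diff_left blinfun.scaleR_left)

lemma pairing_sum_left: "pairing (\<Sum>x\<in>S. g x) \<phi> = (\<Sum>x\<in>S. pairing (g x) \<phi>)"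
  by (induction S rule: infinite_finite_induct) (simp_all add: pairing_simps_left)

lemma lipfree_functional_dirac: "lipfree_functional (dirac x) = lip_delta x"
  unfolding dirac_def
  by (intro Lipfree_inverse) (meson closure_subset range_eqI span_base subsetD)

lemma pairing_dirac:
  assumes "L-lipschitz_on UNIV \<phi>"
  shows "pairing (dirac x) \<phi> = \<phi> x - \<phi> 0"
  by (simp add: pairing_def lipfree_functional_dirac lip_delta.rep_eq lip0_apply_Lip0[OF assms])

lemma pairing_molecule:
  assumes "L-lipschitz_on UNIV \<phi>"
  shows "pairing (molecule u v) \<phi> = (\<phi> v - \<phi> u) / dist u v"
  by (simp add: molecule_def pairing_simps_left pairing_dirac[OF assms] divide_inverse)

lemma norm_dirac_diff_le: "norm (dirac v - dirac u) \<le> dist u v"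
proof (rule lipfree_norm_le)
  fix \<phi> :: "'a \<Rightarrow> real" assume lip: "1-lipschitz_on UNIV \<phi>"
  then show "pairing (dirac v - dirac u) \<phi> \<le> dist u v"
    by (simp add: pairing_simps_left pairing_dirac[OF lip]) (metis dist_commute lipschitz_real_iff mult_1)
qed

lemma norm_molecule_le: "norm (molecule u v) \<le> 1"
  using norm_dirac_diff_le[of v u]
  by (cases "u = v")
    (simp_all add: molecule_def divide_inverse[symmetric] mult.commute[of "inverse _"] divide_le_eq
      del: scaleR_right_diff_distrib)

lemma finite_support_approx:
  fixes \<mu> :: "'m::{metric_space,zero} lipfree"
  assumes "0 < e"
  obtains S a where "finite S" "norm (\<mu> - (\<Sum>x\<in>S. a x *\<^sub>R dirac x)) < e"
proof -
  obtain y where y: "y \<in> span (range (lip_delta :: 'm \<Rightarrow> _))" "dist y (lipfree_functional \<mu>) < e"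
    using lipfree_functional[of \<mu>] assms unfolding closure_approachable by blast
  obtain t r where t: "finite t" "t \<subseteq> range (lip_delta :: 'm \<Rightarrow> _)" "y = (\<Sum>v\<in>t. r v *\<^sub>R v)"
    using y(1) unfolding span_explicit by auto
  obtain S :: "'m set" where S: "inj_on lip_delta S" "t = lip_delta ` S"
    using t(2) unfolding subset_image_inj by blast
  define a where "a x = r (lip_delta x)" for x :: 'm
  have "lipfree_functional (\<Sum>x\<in>S. a x *\<^sub>R dirac x) = (\<Sum>x\<in>S. a x *\<^sub>R lip_delta x)" for S
    by (induction S rule: infinite_finite_induct)
      (simp_all add: zero_lipfree.rep_eq plus_lipfree.rep_eq scaleR_lipfree.rep_eq
        lipfree_functional_dirac)
  also have "(\<Sum>x\<in>S. a x *\<^sub>R lip_delta x) = y"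
    by (simp add: t(3) S sum.reindex a_def)
  finally have "norm (\<mu> - (\<Sum>x\<in>S. a x *\<^sub>R dirac x)) < e"
    using y(2) by (simp add: norm_lipfree.rep_eq minus_lipfree.rep_eq dist_norm norm_minus_commute)
  moreover have "finite S"
    using t(1) S by (simp add: finite_image_iff)
  ultimately show ?thesis
    using that by blast
qed

lemma pairing_dirac_sum:
  assumes "L-lipschitz_on UNIV \<phi>"
  shows "pairing (\<Sum>x\<in>S. a x *\<^sub>R dirac x) \<phi> = (\<Sum>x\<in>S. a x * (\<phi> x - \<phi> 0))"
  by (simp add: pairing_sum_left pairing_simps_left pairing_dirac[OF assms])

text \<open>Only the inclusion of the dual of the free space in the Lipschitz functions needs an argument:
  a functional and the pairing with its restriction to point masses agree on a dense subspace.\<close>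

lemma functional_eq_pairing:
  fixes f :: "'m::{metric_space,zero} lipfree \<Rightarrow>\<^sub>L real"
  defines "F \<equiv> \<lambda>x. blinfun_apply f (dirac x)"
  shows "(norm f)-lipschitz_on UNIV F" and "blinfun_apply f \<nu> = pairing \<nu> F"
proof -
  have "blinfun_apply f (dirac x) - blinfun_apply f (dirac y) \<le> norm f * dist x y" for x y
  proof -
    have "blinfun_apply f (dirac x - dirac y) \<le> norm f * norm (dirac x - dirac y)"
      using norm_blinfun[of f "dirac x - dirac y"] by (simp add: abs_le_iff)
    also have "\<dots> \<le> norm f * dist x y"
      using norm_dirac_diff_le[of x y] by (intro mult_left_mono) (auto simp: dist_commute)
    finally show ?thesis by (simp add: blinfun.diff_right)
  qed
  then show lip: "(norm f)-lipschitz_on UNIV F"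
    by (simp add: lipschitz_real_iff F_def)
  have dirac0: "dirac (0::'m) = 0"
  proof -
    have "norm (dirac (0::'m)) \<le> 0"
      by (rule lipfree_norm_le) (simp add: pairing_dirac[of 1])
    then show ?thesis by simp
  qed
  have "\<bar>blinfun_apply f \<nu> - pairing \<nu> F\<bar> \<le> 0 + e" if "0 < e" for e
  proof -
    have "0 < e / (2 * norm f + 1)"
      using that by (intro divide_pos_pos) (auto simp: add_nonneg_pos)
    then obtain S a where S: "norm (\<nu> - (\<Sum>x\<in>S. a x *\<^sub>R dirac x)) < e / (2 * norm f + 1)"
      by (rule finite_support_approx)
    define \<nu>' where "\<nu>' = (\<Sum>x\<in>S. a x *\<^sub>R dirac x)"
    have agree: "blinfun_apply f \<nu>' = pairing \<nu>' F"
      unfolding \<nu>'_def pairing_dirac_sum[OF lip]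
      by (simp add: blinfun.sum_right blinfun.scaleR_right F_def dirac0)
    have "\<bar>blinfun_apply f \<nu> - pairing \<nu> F\<bar>
        \<le> \<bar>blinfun_apply f (\<nu> - \<nu>')\<bar> + \<bar>pairing (\<nu> - \<nu>') F\<bar>"
      by (simp add: blinfun.diff_right pairing_simps_left agree)
    also have "\<dots> \<le> norm f * norm (\<nu> - \<nu>') + norm (\<nu> - \<nu>') * norm f"
      using norm_blinfun[of f "\<nu> - \<nu>'"] abs_pairing_le[OF lip, of "\<nu> - \<nu>'"]
      by (intro add_mono) simp_all
    also have "\<dots> \<le> (2 * norm f + 1) * norm (\<nu> - \<nu>')"
      by (simp add: algebra_simps)
    also have "\<dots> \<le> e"
      using S unfolding \<nu>'_def by (simp add: less_divide_eq mult.commute add_nonneg_pos)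
    finally show ?thesis by simp
  qed
  then have "\<bar>blinfun_apply f \<nu> - pairing \<nu> F\<bar> \<le> 0"
    by (rule field_le_epsilon)
  then show "blinfun_apply f \<nu> = pairing \<nu> F"
    by simp
qed

lemma pairing_functional_exists:
  fixes \<phi> :: "'m::{metric_space,zero} \<Rightarrow> real"
  assumes "L-lipschitz_on UNIV \<phi>"
  obtains f :: "'m lipfree \<Rightarrow>\<^sub>L real" where "\<And>\<nu>. blinfun_apply f \<nu> = pairing \<nu> \<phi>"
proof -
  have "bounded_linear (\<lambda>\<nu>. pairing \<nu> \<phi>)"
    using abs_pairing_le[OF assms]
    by (intro bounded_linear_intro[where K = L]) (auto simp: pairing_simps_left)
  then show ?thesis
    using that[of "Blinfun (\<lambda>\<nu>. pairing \<nu> \<phi>)"] by (simp add: bounded_linear_Blinfun_apply)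
qed

section \<open>Geodesics and nearest points in a tree\<close>

definition geodesic_on :: "'t::metric_space set \<Rightarrow> (real \<Rightarrow> 't) \<Rightarrow> real \<Rightarrow> bool"
  where "geodesic_on T \<gamma> l \<longleftrightarrow> 0 \<le> l \<and> \<gamma> ` {0..l} \<subseteq> T \<and>
    (\<forall>s\<in>{0..l}. \<forall>t\<in>{0..l}. dist (\<gamma> s) (\<gamma> t) = \<bar>s - t\<bar>)"

lemma geodesic_onD:
  assumes "geodesic_on T \<gamma> l"
  shows "0 \<le> l" and "s \<in> {0..l} \<Longrightarrow> \<gamma> s \<in> T"
    and "s \<in> {0..l} \<Longrightarrow> t \<in> {0..l} \<Longrightarrow> dist (\<gamma> s) (\<gamma> t) = \<bar>s - t\<bar>"
  using assms by (auto simp: geodesic_on_def)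

lemma geodesic_on_inj: "geodesic_on T \<gamma> l \<Longrightarrow> inj_on \<gamma> {0..l}"
  by (rule inj_onI) (metis dist_self geodesic_onD(3) abs_eq_0 right_minus_eq)

lemma geodesic_on_continuous: "geodesic_on T \<gamma> l \<Longrightarrow> continuous_on {0..l} \<gamma>"
  by (rule lipschitz_on_continuous_on[of 1])
    (auto simp: lipschitz_on_def geodesic_onD(3) dist_real_def)

lemma geodesic_on_arc:
  assumes "geodesic_on T \<gamma> l" "s \<in> {0..l}" "t \<in> {0..l}" "s \<noteq> t"
  shows "arc (\<gamma> \<circ> linepath s t)" and "path_image (\<gamma> \<circ> linepath s t) = \<gamma> ` closed_segment s t"
    and "\<gamma> ` closed_segment s t \<subseteq> \<gamma> ` {0..l}" and "\<gamma> ` closed_segment s t \<subseteq> T"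
proof -
  have sub: "closed_segment s t \<subseteq> {0..l}"
    using assms(2,3) by (auto simp: closed_segment_eq_real_ivl)
  have "path (\<gamma> \<circ> linepath s t)"
    using geodesic_on_continuous[OF assms(1)] sub
    by (intro path_continuous_image) (auto intro: continuous_on_subset)
  moreover have "inj_on (\<gamma> \<circ> linepath s t) {0..1}"
  proof (rule comp_inj_on)
    show "inj_on (linepath s t) {0..1}"
      using arc_linepath[OF assms(4)] by (rule arc_imp_inj_on)
    show "inj_on \<gamma> (linepath s t ` {0..1})"
      using geodesic_on_inj[OF assms(1)] sub by (simp add: linepath_image_01 inj_on_subset)
  qed
  ultimately show "arc (\<gamma> \<circ> linepath s t)"
    by (simp add: arc_def)
  show "path_image (\<gamma> \<circ> linepath s t) = \<gamma> ` closed_segment s t"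
    by (simp add: path_image_compose)
  show "\<gamma> ` closed_segment s t \<subseteq> \<gamma> ` {0..l}" "\<gamma> ` closed_segment s t \<subseteq> T"
    using sub assms(1) by (auto simp: geodesic_on_def)
qed

lemma geodesic_on_arc_between:
  assumes "geodesic_on T \<gamma> l" "0 < l"
  shows "arc_between T (\<gamma> 0) (\<gamma> l) (\<gamma> ` {0..l})"
  unfolding arc_between_def
proof (intro conjI exI)
  have l: "0 \<in> {0..l}" "l \<in> {0..l}" "0 \<noteq> l" "closed_segment 0 l = {0..l}"
    using assms(2) by (auto simp: closed_segment_eq_real_ivl)
  note arc = geodesic_on_arc[OF assms(1) l(1-3)]
  show "arc (\<gamma> \<circ> linepath 0 l)" "path_image (\<gamma> \<circ> linepath 0 l) = \<gamma> ` {0..l}"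
    using arc by (simp_all add: l(4))
  show "\<gamma> ` {0..l} \<subseteq> T"
    using assms(1) by (simp add: geodesic_on_def)
qed (simp_all add: pathstart_compose pathfinish_compose)

text \<open>The isometric parametrization of an arc may run either way; reversing it if necessary gives
  a geodesic with the prescribed start.\<close>

lemma real_tree_geodesic:
  assumes "real_tree T" "x \<in> T" "y \<in> T"
  obtains \<gamma> where "geodesic_on T \<gamma> (dist x y)" "\<gamma> 0 = x" "\<gamma> (dist x y) = y"
proof (cases "x = y")
  case True
  then show ?thesis
    using that[of "\<lambda>_. x"] assms by (auto simp: geodesic_on_def)
next
  case False
  define l where "l = dist x y"
  obtain A where A: "arc_between T x y A" "isometric_to_segment A l"
    using assms False unfolding real_tree_def l_def by blast
  then obtain h where h: "h ` {0..l} = A" "\<And>s t. s \<in> {0..l} \<Longrightarrow> t \<in> {0..l} \<Longrightarrow> dist (h s) (h t) = \<bar>s - t\<bar>"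
    unfolding isometric_to_segment_def dist_real_def by blast
  have sub: "A \<subseteq> T" "x \<in> A" "y \<in> A"
    using A(1) unfolding arc_between_def by auto
  then obtain s t where st: "s \<in> {0..l}" "t \<in> {0..l}" "h s = x" "h t = y"
    using h(1) by blast
  have st': "\<bar>s - t\<bar> = l"
    using h(2)[OF st(1,2)] st by (simp add: l_def)
  then consider "s = 0" "t = l" | "s = l" "t = 0"
    using st by fastforce
  then show ?thesis
  proof cases
    case 1
    then show ?thesis
      using that[of h] h st sub by (auto simp: geodesic_on_def l_def)
  next
    case 2
    show ?thesis
    proof (rule that[of "\<lambda>u. h (l - u)"])
      have "h (l - u) \<in> T" if "u \<in> {0..l}" for u
      proof -
        have "l - u \<in> {0..l}" using that by auto
        then show ?thesis using h(1) sub by blast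
      qed
      moreover have "dist (h (l - u)) (h (l - v)) = \<bar>u - v\<bar>" if "u \<in> {0..l}" "v \<in> {0..l}" for u v
        using that h(2)[of "l - u" "l - v"] by auto
      ultimately show "geodesic_on T (\<lambda>u. h (l - u)) (dist x y)"
        by (auto simp: geodesic_on_def l_def[symmetric]) (simp add: l_def)
    qed (use 2 st in \<open>auto simp: l_def[symmetric]\<close>)
  qed
qed

text \<open>Two arcs meeting only in a common endpoint concatenate to an arc, and this is the unique and
  isometric one.\<close>

lemma real_tree_glue:
  assumes T: "real_tree T"
    and g: "arc g1" "arc g2" "path_image g1 \<subseteq> T" "path_image g2 \<subseteq> T"
    and ends: "pathstart g1 = a" "pathfinish g1 = b" "pathstart g2 = b" "pathfinish g2 = c"
    and meet: "path_image g1 \<inter> path_image g2 \<subseteq> {b}"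
  shows "dist a c = dist a b + dist b c" and "arc_between T a c A \<Longrightarrow> b \<in> A"
proof -
  define J where "J = path_image (g1 +++ g2)"
  have arc: "arc (g1 +++ g2)"
    using g ends meet by (intro arc_join) auto
  have J: "J = path_image g1 \<union> path_image g2"
    unfolding J_def using ends by (intro path_image_join) simp
  have between: "arc_between T a c J"
    unfolding arc_between_def using arc g ends J J_def
    by (intro conjI exI[of _ "g1 +++ g2"]) auto
  have "a \<noteq> c"
    using arc_distinct_ends[OF arc] ends by simp
  moreover have "a \<in> T" "c \<in> T"
    using g ends by auto
  ultimately have iso: "isometric_to_segment J (dist a c)"
    and unique: "arc_between T a c A \<Longrightarrow> A = J" for A
    using T[unfolded real_tree_def, rule_format, of a c] between by blast+
  have mem: "a \<in> J" "b \<in> J" "c \<in> J"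
    using ends by (auto simp: J)
  show "b \<in> A" if "arc_between T a c A"
    using unique[OF that] mem by simp
  obtain h where h: "h ` {0..dist a c} = J"
      "\<And>s t. s \<in> {0..dist a c} \<Longrightarrow> t \<in> {0..dist a c} \<Longrightarrow> dist (h s) (h t) = \<bar>s - t\<bar>"
    using iso unfolding isometric_to_segment_def dist_real_def by blast
  obtain s t u where "s \<in> {0..dist a c}" "t \<in> {0..dist a c}" "u \<in> {0..dist a c}"
      "h s = a" "h t = b" "h u = c"
    using mem unfolding h(1)[symmetric] by blast
  then show "dist a c = dist a b + dist b c"
    using h(2)[of s t] h(2)[of t u] h(2)[of s u] by auto
qed

text \<open>The geodesic from \<open>z\<close> to a nearest point of the segment meets the segment nowhere else, so the two
  can be glued.\<close>

lemma nearest_point_additive: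
  assumes T: "real_tree T" and \<gamma>: "geodesic_on T \<gamma> l" and z: "z \<in> T" and t: "t \<in> {0..l}"
    and nearest: "\<And>s. s \<in> {0..l} \<Longrightarrow> dist z (\<gamma> t) \<le> dist z (\<gamma> s)"
    and s: "s \<in> {0..l}"
  shows "dist z (\<gamma> s) = dist z (\<gamma> t) + \<bar>s - t\<bar>"
proof (cases "z = \<gamma> t \<or> s = t")
  case True
  then show ?thesis
    using geodesic_onD(3)[OF \<gamma> t s] by auto
next
  case False
  define m where "m = dist z (\<gamma> t)"
  have m: "0 < m" "0 \<in> {0..m}" "m \<in> {0..m}" "0 \<noteq> m" and seg: "closed_segment 0 m = {0..m}"
    using False by (auto simp: m_def closed_segment_eq_real_ivl)
  obtain \<sigma> where \<sigma>: "geodesic_on T \<sigma> m" "\<sigma> 0 = z" "\<sigma> m = \<gamma> t"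
    using real_tree_geodesic[OF T z geodesic_onD(2)[OF \<gamma> t]] unfolding m_def by blast
  note arc1 = geodesic_on_arc[OF \<sigma>(1) m(2,3,4)]
    and arc2 = geodesic_on_arc[OF \<gamma> t s] 
  have "path_image (\<sigma> \<circ> linepath 0 m) \<inter> path_image (\<gamma> \<circ> linepath t s) \<subseteq> {\<gamma> t}"
  proof
    fix v assume "v \<in> path_image (\<sigma> \<circ> linepath 0 m) \<inter> path_image (\<gamma> \<circ> linepath t s)"
    then obtain u s' where v: "u \<in> {0..m}" "v = \<sigma> u" "s' \<in> {0..l}" "v = \<gamma> s'"
      using arc1 arc2 False by (auto simp: seg)
    then have "m \<le> dist (\<sigma> 0) (\<sigma> u)"
      using nearest[OF v(3)] \<sigma> by (simp add: m_def)
    then have "u = m"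
      using geodesic_onD(3)[OF \<sigma>(1), of 0 u] v(1) m(1) by auto
    then show "v \<in> {\<gamma> t}"
      using v \<sigma> by simp
  qed
  then have "dist z (\<gamma> s) = dist z (\<gamma> t) + dist (\<gamma> t) (\<gamma> s)"
    using arc1 arc2 \<sigma> \<gamma> False
    by (intro real_tree_glue(1)[OF T, of "\<sigma> \<circ> linepath 0 m" "\<gamma> \<circ> linepath t s"])
      (auto simp: pathstart_compose pathfinish_compose seg)
  then show ?thesis
    using geodesic_onD(3)[OF \<gamma> t s] by simp
qed

text \<open>If two points project to different points of a segment, the geodesic between them runs through
  both feet. For this, the geodesics from \<open>z\<close> and from \<open>w\<close> to the foot \<open>\<gamma> r\<close> of \<open>w\<close> must not meet earlier.
  A point on the latter is farther from \<open>\<gamma> t\<close> than from \<open>\<gamma> r\<close>, by the distance of the two feet; the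
  former passes through \<open>\<gamma> t\<close> and has no such point except its end.\<close>

lemma two_projections_additive:
  assumes T: "real_tree T" and \<gamma>: "geodesic_on T \<gamma> l"
    and z: "z \<in> T" "t \<in> {0..l}" "\<And>s. s \<in> {0..l} \<Longrightarrow> dist z (\<gamma> s) = dist z (\<gamma> t) + \<bar>s - t\<bar>"
    and w: "w \<in> T" "r \<in> {0..l}" "\<And>s. s \<in> {0..l} \<Longrightarrow> dist w (\<gamma> s) = dist w (\<gamma> r) + \<bar>s - r\<bar>"
    and "t \<noteq> r"
  shows "dist z w = dist z (\<gamma> t) + \<bar>t - r\<bar> + dist (\<gamma> r) w"
proof -
  define q q' where "q = \<gamma> t" and "q' = \<gamma> r"
  have qT: "q \<in> T" "q' \<in> T"
    using geodesic_onD(2)[OF \<gamma>] z w by (auto simp: q_def q'_def)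
  have qq: "dist q q' = \<bar>t - r\<bar>" "q \<noteq> q'"
    using geodesic_onD(3)[OF \<gamma> z(2) w(2)] \<open>t \<noteq> r\<close> by (auto simp: q_def q'_def)
  have zq': "dist z q' = dist z q + dist q q'"
    using z(3)[OF w(2)] qq by (simp add: q_def q'_def abs_minus_commute)
  show ?thesis
  proof (cases "w = q'")
    case True
    then show ?thesis
      using zq' qq by (simp add: q_def q'_def)
  next
    case False
    define m n where "m = dist z q'" and "n = dist w q'"
    have "0 < dist z q'"
      using zq' qq(2) zero_le_dist[of z q] zero_less_dist_iff[of q q'] by linarith
    then have pos: "0 < m" "0 < n" and ends: "0 \<in> {0..m}" "m \<in> {0..m}" "0 \<in> {0..n}" "n \<in> {0..n}" "0 \<noteq> m" "n \<noteq> 0"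
      using False by (auto simp: m_def n_def)
    have seg: "closed_segment 0 m = {0..m}" "closed_segment n 0 = {0..n}"
      using pos by (auto simp: closed_segment_eq_real_ivl)
    obtain \<rho> where \<rho>: "geodesic_on T \<rho> m" "\<rho> 0 = z" "\<rho> m = q'"
      using real_tree_geodesic[OF T z(1) qT(2)] unfolding m_def by blast
    obtain \<sigma> where \<sigma>: "geodesic_on T \<sigma> n" "\<sigma> 0 = w" "\<sigma> n = q'"
      using real_tree_geodesic[OF T w(1) qT(2)] unfolding n_def by blast
    note arc1 = geodesic_on_arc[OF \<rho>(1) ends(1,2,5)]
      and arc2 = geodesic_on_arc[OF \<sigma>(1) ends(4,3,6)]
    have "q \<in> \<rho> ` {0..m}"
    proof (cases "z = q")
      case True
      then show ?thesis using \<rho>(2) ends by auto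
    next
      case False
      define k where "k = dist z q"
      have k: "0 \<in> {0..k}" "k \<in> {0..k}" "0 \<noteq> k" and segk: "closed_segment 0 k = {0..k}"
        using False by (auto simp: k_def closed_segment_eq_real_ivl)
      obtain \<tau> where \<tau>: "geodesic_on T \<tau> k" "\<tau> 0 = z" "\<tau> k = q"
        using real_tree_geodesic[OF T z(1) qT(1)] unfolding k_def by blast
      note arc3 = geodesic_on_arc[OF \<tau>(1) k]
        and arc4 = geodesic_on_arc[OF \<gamma> z(2) w(2) \<open>t \<noteq> r\<close>]
      have "path_image (\<tau> \<circ> linepath 0 k) \<inter> path_image (\<gamma> \<circ> linepath t r) \<subseteq> {q}"
      proof
        fix v assume "v \<in> path_image (\<tau> \<circ> linepath 0 k) \<inter> path_image (\<gamma> \<circ> linepath t r)"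
        then obtain u s' where v: "u \<in> {0..k}" "v = \<tau> u" "s' \<in> {0..l}" "v = \<gamma> s'"
          using arc3 arc4 by (auto simp: segk)
        then have "k \<le> dist (\<tau> 0) (\<tau> u)"
          using z(3)[OF v(3)] \<tau> by (simp add: k_def q_def)
        then have "u = k"
          using geodesic_onD(3)[OF \<tau>(1), of 0 u] v(1) k by auto
        then show "v \<in> {q}"
          using v \<tau> by simp
      qed
      moreover have "arc_between T z q' (\<rho> ` {0..m})"
        using geodesic_on_arc_between[OF \<rho>(1) pos(1)] \<rho> by simp
      ultimately show ?thesis
        using arc3 arc4 \<tau> \<gamma>
        by (intro real_tree_glue(2)[OF T, of "\<tau> \<circ> linepath 0 k" "\<gamma> \<circ> linepath t r" z q q'])
          (auto simp: pathstart_compose pathfinish_compose segk q_def q'_def)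
    qed
    then obtain x where x: "x \<in> {0..m}" "\<rho> x = q"
      by blast
    have "path_image (\<rho> \<circ> linepath 0 m) \<inter> path_image (\<sigma> \<circ> linepath n 0) \<subseteq> {q'}"
    proof
      fix v assume "v \<in> path_image (\<rho> \<circ> linepath 0 m) \<inter> path_image (\<sigma> \<circ> linepath n 0)"
      then obtain u u' where v: "u \<in> {0..m}" "v = \<rho> u" "u' \<in> {0..n}" "v = \<sigma> u'"
        using arc1 arc2 by (auto simp: seg)
      have "dist w v + dist v q' = dist w q'"
        using geodesic_onD(3)[OF \<sigma>(1), of 0 u'] geodesic_onD(3)[OF \<sigma>(1), of u' n] v \<sigma> ends
        by (auto simp: n_def)
      then have vq: "dist v q' + dist q q' \<le> dist v q"
        using w(3)[OF z(2)] dist_triangle[of w q v] qq by (simp add: q_def q'_def)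
      have "dist v q = \<bar>u - x\<bar>" "dist v q' = \<bar>u - m\<bar>" "dist q q' = \<bar>x - m\<bar>"
        using geodesic_onD(3)[OF \<rho>(1)] v x \<rho> ends by (metis atLeastAtMost_iff)+
      moreover have "x \<noteq> m"
        using x \<rho> qq by auto
      ultimately have "dist v q' = 0"
        using vq v x by auto
      then show "v \<in> {q'}"
        by simp
    qed
    then have "dist z w = dist z q' + dist q' w"
      using arc1 arc2 \<rho> \<sigma>
      by (intro real_tree_glue(1)[OF T, of "\<rho> \<circ> linepath 0 m" "\<sigma> \<circ> linepath n 0"])
        (auto simp: pathstart_compose pathfinish_compose seg)
    then show ?thesis
      using zq' qq by (simp add: q_def q'_def)
  qed
qed

lemma real_tree_projection:
  assumes T: "real_tree T" and \<gamma>: "geodesic_on T \<gamma> l"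
  obtains p where "\<And>z. z \<in> T \<Longrightarrow> p z \<in> {0..l}"
    and "\<And>z s. z \<in> T \<Longrightarrow> s \<in> {0..l} \<Longrightarrow> dist z (\<gamma> s) = dist z (\<gamma> (p z)) + \<bar>s - p z\<bar>"
    and "\<And>z w. z \<in> T \<Longrightarrow> w \<in> T \<Longrightarrow> p z \<noteq> p w \<Longrightarrow>
      dist z w = dist z (\<gamma> (p z)) + \<bar>p z - p w\<bar> + dist (\<gamma> (p w)) w"
proof -
  have "\<exists>t\<in>{0..l}. \<forall>s\<in>{0..l}. dist z (\<gamma> t) \<le> dist z (\<gamma> s)" for z
    using geodesic_onD(1)[OF \<gamma>] geodesic_on_continuous[OF \<gamma>]
    by (intro continuous_attains_inf) (auto intro!: continuous_intros)
  then obtain p where p: "\<And>z. p z \<in> {0..l}" "\<And>z s. s \<in> {0..l} \<Longrightarrow> dist z (\<gamma> (p z)) \<le> dist z (\<gamma> s)"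
    by metis
  have add: "dist z (\<gamma> s) = dist z (\<gamma> (p z)) + \<bar>s - p z\<bar>" if "z \<in> T" "s \<in> {0..l}" for z s
    using nearest_point_additive[OF T \<gamma> that(1) p(1) p(2) that(2)] by blast
  show ?thesis
    using that[of p] p(1) add two_projections_additive[OF T \<gamma> _ p(1) add _ p(1) add] by blast
qed

section \<open>Changing the slope of a Lipschitz function on a segment\<close>

definition clip :: "real \<Rightarrow> real \<Rightarrow> real \<Rightarrow> real"
  where "clip a b s = max a (min b s)"

lemma clip_range: "a \<le> b \<Longrightarrow> a \<le> clip a b s" "a \<le> b \<Longrightarrow> clip a b s \<le> b"
  by (auto simp: clip_def)

lemma clip_below: "s \<le> a \<Longrightarrow> clip a b s = a"
  and clip_above: "a \<le> b \<Longrightarrow> b \<le> s \<Longrightarrow> clip a b s = b"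
  and clip_inside: "a \<le> s \<Longrightarrow> s \<le> b \<Longrightarrow> clip a b s = s"
  by (auto simp: clip_def)

lemma clip_clip:
  assumes "a\<^sub>0 \<le> a" "a \<le> b" "b \<le> b\<^sub>0"
  shows "clip a b (clip a\<^sub>0 b\<^sub>0 s) = clip a b s"
  using assms by (simp add: clip_def max_def min_def)

lemma lipschitz_extension_exists:
  fixes \<iota> :: "'m::metric_space \<Rightarrow> 't::metric_space" and \<phi> :: "'m \<Rightarrow> real"
  assumes iso: "\<And>x y. dist (\<iota> x) (\<iota> y) = dist x y" and lip: "L-lipschitz_on UNIV \<phi>"
  obtains H where "L-lipschitz_on UNIV H" "\<And>x. H (\<iota> x) = \<phi> x"
proof -
  define H where "H z = (INF x. \<phi> x + L * dist z (\<iota> x))" for z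
  have L: "0 \<le> L" and diff: "\<phi> x - \<phi> y \<le> L * dist (\<iota> x) (\<iota> y)" for x y
    using lip by (auto simp: lipschitz_real_iff iso)
  have tri: "L * dist x z \<le> L * dist x y + L * dist y z" for x y z :: 't
    using mult_left_mono[OF dist_triangle L] by (simp add: distrib_left)
  have bdd: "bdd_below (range (\<lambda>x. \<phi> x + L * dist z (\<iota> x)))" for z
  proof (rule bdd_belowI2)
    fix x
    show "\<phi> undefined - L * dist (\<iota> undefined) z \<le> \<phi> x + L * dist z (\<iota> x)"
      using diff[of undefined x] tri[of "\<iota> undefined" "\<iota> x" z] by simp
  qed
  have "H z - H w \<le> L * dist z w" for z w
  proof -
    have "H z - L * dist z w \<le> H w"
      unfolding H_def[of w]
    proof (rule cINF_greatest)
      fix x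
      have "H z \<le> \<phi> x + L * dist z (\<iota> x)"
        unfolding H_def by (rule cINF_lower[OF bdd]) simp
      then show "H z - L * dist z w \<le> \<phi> x + L * dist w (\<iota> x)"
        using tri[of z "\<iota> x" w] by linarith
    qed simp
    then show ?thesis by simp
  qed
  then have "L-lipschitz_on UNIV H"
    using L by (simp add: lipschitz_real_iff)
  moreover have "H (\<iota> x) = \<phi> x" for x
  proof (rule antisym)
    show "H (\<iota> x) \<le> \<phi> x"
      using cINF_lower[OF bdd[of "\<iota> x"], of x] by (simp add: H_def)
    show "\<phi> x \<le> H (\<iota> x)"
      unfolding H_def
    proof (rule cINF_greatest)
      fix y
      show "\<phi> x \<le> \<phi> y + L * dist (\<iota> x) (\<iota> y)"
        using diff[of x y] by linarith
    qed simp
  qed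
  ultimately show ?thesis using that by blast
qed

text \<open>What the estimates need of the tree: \<open>\<gamma> (p x)\<close> is the foot of \<open>x\<close> on the geodesic \<open>\<gamma>\<close>, and
  geodesics between points with different feet run through these feet. The points of \<open>\<gamma>\<close>, its ends
  included, need not belong to the space.\<close>

locale tree_segment =
  fixes \<iota> :: "'m::{metric_space,zero} \<Rightarrow> 't::metric_space"
    and \<gamma> :: "real \<Rightarrow> 't" and l :: real and p :: "'m \<Rightarrow> real"
  assumes dist_embed: "dist (\<iota> x) (\<iota> y) = dist x y"
    and length_nonneg: "0 \<le> l"
    and dist_on_segment: "s \<in> {0..l} \<Longrightarrow> t \<in> {0..l} \<Longrightarrow> dist (\<gamma> s) (\<gamma> t) = \<bar>s - t\<bar>"
    and foot_range: "p x \<in> {0..l}"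
    and dist_foot: "s \<in> {0..l} \<Longrightarrow> dist (\<iota> x) (\<gamma> s) = dist (\<iota> x) (\<gamma> (p x)) + \<bar>s - p x\<bar>"
    and dist_through: "p x \<noteq> p y \<Longrightarrow>
      dist x y = dist (\<iota> x) (\<gamma> (p x)) + \<bar>p x - p y\<bar> + dist (\<gamma> (p y)) (\<iota> y)"
begin

lemma dist_through_clip:
  assumes "0 \<le> a" "a \<le> b" "b \<le> l" and ne: "clip a b (p x) \<noteq> clip a b (p y)"
  shows "dist x y = dist (\<iota> x) (\<gamma> (clip a b (p x))) + \<bar>clip a b (p x) - clip a b (p y)\<bar>
    + dist (\<gamma> (clip a b (p y))) (\<iota> y)"
proof -
  have in_range: "clip a b s \<in> {0..l}" for s
    using assms clip_range[of a b s] by auto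
  have "\<bar>p x - p y\<bar> = \<bar>clip a b (p x) - p x\<bar> + \<bar>clip a b (p x) - clip a b (p y)\<bar>
      + \<bar>clip a b (p y) - p y\<bar>"
    using ne \<open>a \<le> b\<close> by (auto simp: clip_def max_def min_def abs_if split: if_splits)
  moreover have "p x \<noteq> p y"
    using ne by auto
  ultimately show ?thesis
    using dist_through[of x y] dist_foot[OF in_range[of "p x"], of x]
      dist_foot[OF in_range[of "p y"], of y] by (simp add: dist_commute)
qed

text \<open>Subtracting the values along the part of the geodesic between \<open>a\<close> and \<open>b\<close> makes \<open>H\<close> constant there
  without changing its slopes elsewhere; then the coordinate adds the slope \<open>\<sigma>\<close>. A path between two
  points of the tree is composed of a piece in this part and pieces outside of it, and each
  contributes at most its length.\<close>

lemma reslope_lipschitz: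
  fixes H :: "'t \<Rightarrow> real"
  assumes ab: "0 \<le> a" "a \<le> b" "b \<le> l" and H: "1-lipschitz_on UNIV H" and \<sigma>: "\<bar>\<sigma>\<bar> \<le> 1"
  shows "1-lipschitz_on UNIV (\<lambda>x. H (\<iota> x) - H (\<gamma> (clip a b (p x))) + \<sigma> * clip a b (p x))"
proof -
  have diff: "H z - H w \<le> dist z w" for z w
    using H by (simp add: lipschitz_real_iff)
  have "(H (\<iota> x) - H (\<gamma> (clip a b (p x))) + \<sigma> * clip a b (p x))
      - (H (\<iota> y) - H (\<gamma> (clip a b (p y))) + \<sigma> * clip a b (p y)) \<le> dist x y" for x y
  proof (cases "clip a b (p x) = clip a b (p y)")
    case True
    then show ?thesis
      using diff[of "\<iota> x" "\<iota> y"] by (simp add: dist_embed)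
  next
    case False
    have "\<sigma> * clip a b (p x) - \<sigma> * clip a b (p y) \<le> \<bar>\<sigma> * (clip a b (p x) - clip a b (p y))\<bar>"
      by (simp add: right_diff_distrib)
    also have "\<dots> \<le> \<bar>clip a b (p x) - clip a b (p y)\<bar>"
      using mult_right_mono[OF \<sigma>] by (simp add: abs_mult)
    finally show ?thesis
      using dist_through_clip[OF ab False] diff[of "\<iota> x" "\<gamma> (clip a b (p x))"]
        diff[of "\<gamma> (clip a b (p y))" "\<iota> y"] by linarith
  qed
  then show ?thesis
    by (simp add: lipschitz_real_iff)
qed

lemma clip_lipschitz:
  assumes "0 \<le> a" "a \<le> b" "b \<le> l"
  shows "1-lipschitz_on UNIV (\<lambda>x. clip a b (p x))"
  using reslope_lipschitz[OF assms, of "\<lambda>_. 0" 1] by (simp add: lipschitz_real_iff)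

lemma along_segment_lipschitz:
  fixes H :: "'t \<Rightarrow> real"
  assumes ab: "0 \<le> a" "a \<le> b" "b \<le> l" and H: "1-lipschitz_on UNIV H"
  shows "1-lipschitz_on UNIV (\<lambda>x. H (\<gamma> (clip a b (p x))))"
proof -
  have "H (\<gamma> (clip a b (p x))) - H (\<gamma> (clip a b (p y))) \<le> dist x y" for x y
  proof -
    have "H (\<gamma> (clip a b (p x))) - H (\<gamma> (clip a b (p y)))
        \<le> dist (\<gamma> (clip a b (p x))) (\<gamma> (clip a b (p y)))"
      using H by (simp add: lipschitz_real_iff)
    also have "\<dots> = \<bar>clip a b (p x) - clip a b (p y)\<bar>"
      using ab clip_range[of a b] by (intro dist_on_segment) (auto intro: order_trans)
    also have "\<dots> \<le> dist x y"
      using lipschitz_onD[OF clip_lipschitz[OF ab], of x y] by (simp add: dist_real_def)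
    finally show ?thesis .
  qed
  then show ?thesis
    by (simp add: lipschitz_real_iff)
qed

lemma pairing_reslope:
  fixes H :: "'t \<Rightarrow> real"
  assumes ab: "0 \<le> a" "a \<le> b" "b \<le> l" and H: "1-lipschitz_on UNIV H" and \<sigma>: "\<bar>\<sigma>\<bar> \<le> 1"
  shows "pairing \<mu> (\<lambda>x. H (\<iota> x) - H (\<gamma> (clip a b (p x))) + \<sigma> * clip a b (p x))
    = pairing \<mu> (\<lambda>x. H (\<iota> x)) - pairing \<mu> (\<lambda>x. H (\<gamma> (clip a b (p x))))
      + \<sigma> * pairing \<mu> (\<lambda>x. clip a b (p x))"
proof -
  have H\<iota>: "1-lipschitz_on UNIV (\<lambda>x. H (\<iota> x))"
    using H by (simp add: lipschitz_real_iff dist_embed[symmetric])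
  note along = along_segment_lipschitz[OF ab H]
  note slope = clip_lipschitz[OF ab]
  show ?thesis
    using pairing_add[OF lipschitz_on_diff[OF H\<iota> along] lipschitz_on_cmult_real[OF slope], of \<mu> \<sigma>]
      pairing_diff[OF H\<iota> along, of \<mu>] pairing_cmult[OF slope, of \<mu> \<sigma>] by simp
qed

lemma rising_along_segment:
  fixes H :: "'t \<Rightarrow> real"
  assumes H: "1-lipschitz_on UNIV H" and "0 \<le> a" "b \<le> l"
  shows "mono_on {a..b} (\<lambda>s. H (\<gamma> s) + s)"
proof (rule mono_onI)
  fix s t assume st: "s \<in> {a..b}" "t \<in> {a..b}" "s \<le> t"
  have "H (\<gamma> s) - H (\<gamma> t) \<le> dist (\<gamma> s) (\<gamma> t)"
    using H by (simp add: lipschitz_real_iff)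
  also have "\<dots> = t - s"
    using st assms by (subst dist_on_segment) auto
  finally show "H (\<gamma> s) + s \<le> H (\<gamma> t) + t"
    by simp
qed

text \<open>Giving an almost norming function slope \<open>-1\<close> on a short segment hardly changes its pairing with
  a finitely supported element, because up to a constant its values change by at most twice
  the length of the segment.\<close>

lemma short_molecule_estimate:
  assumes ends: "\<gamma> 0 = \<iota> u" "\<gamma> l = \<iota> v" "0 < l" and \<phi>: "1-lipschitz_on UNIV \<phi>"
    and approx: "norm (\<mu> - (\<Sum>x\<in>S. a x *\<^sub>R dirac x)) \<le> e"
  shows "pairing \<mu> \<phi> + 1 - 2 * e - 2 * l * (\<Sum>x\<in>S. \<bar>a x\<bar>) \<le> norm (\<mu> - molecule u v)"
proof -
  obtain H where H: "1-lipschitz_on UNIV H" "\<And>x. H (\<iota> x) = \<phi> x"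
    using lipschitz_extension_exists[OF dist_embed \<phi>] by blast
  have l: "0 \<le> (0::real)" "0 \<le> l" "l \<le> l" using length_nonneg by auto
  have duv: "dist u v = l"
    using dist_on_segment[of 0 l] ends by (simp add: dist_embed[symmetric])
  have "dist (\<iota> u) (\<gamma> (p u)) + p u = 0" "dist (\<iota> v) (\<gamma> (p v)) + (l - p v) = 0"
    using dist_foot[of 0 u] dist_foot[of l v] ends foot_range[of u] foot_range[of v] by simp_all
  then have pu: "p u = 0" and pv: "p v = l"
    using zero_le_dist[of "\<iota> u" "\<gamma> (p u)"] zero_le_dist[of "\<iota> v" "\<gamma> (p v)"]
      foot_range[of u] foot_range[of v] unfolding atLeastAtMost_iff by linarith+
  define h where "h x = H (\<iota> x) - H (\<gamma> (clip 0 l (p x))) + (-1) * clip 0 l (p x)" for x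
  define R where "R x = H (\<gamma> (clip 0 l (p x))) + clip 0 l (p x)" for x
  have h: "1-lipschitz_on UNIV h"
    unfolding h_def by (rule reslope_lipschitz[OF l H(1)]) simp
  have R: "2-lipschitz_on UNIV R"
    using lipschitz_on_add[OF along_segment_lipschitz[OF l H(1)] clip_lipschitz[OF l]]
    by (simp add: R_def)
  have \<mu>h: "pairing \<mu> h = pairing \<mu> \<phi> - pairing \<mu> R"
    using pairing_reslope[OF l H(1), of "-1" \<mu>]
      pairing_add[OF along_segment_lipschitz[OF l H(1)] clip_lipschitz[OF l], of \<mu>]
    unfolding h_def R_def by (simp only: H(2))
  define \<nu> where "\<nu> = (\<Sum>x\<in>S. a x *\<^sub>R dirac x)"
  have "\<bar>(H (\<gamma> s) + s) - (H (\<gamma> t) + t)\<bar> \<le> 2 * l" if "s \<in> {0..l}" "t \<in> {0..l}" for s t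
  proof -
    have "\<bar>H (\<gamma> s) - H (\<gamma> t)\<bar> \<le> \<bar>s - t\<bar>"
      using lipschitz_onD[OF H(1), of "\<gamma> s" "\<gamma> t"] dist_on_segment[OF that] by (simp add: dist_real_def)
    then show ?thesis
      using that by (auto simp: abs_le_iff)
  qed
  then have "\<bar>R x - R 0\<bar> \<le> 2 * l" for x
    unfolding R_def using length_nonneg clip_range[of 0 l] by simp
  then have "\<bar>a x * (R x - R 0)\<bar> \<le> 2 * l * \<bar>a x\<bar>" for x
    using mult_left_mono[of "\<bar>R x - R 0\<bar>" "2 * l" "\<bar>a x\<bar>"] by (simp add: abs_mult mult.commute)
  then have "\<bar>pairing \<nu> R\<bar> \<le> 2 * l * (\<Sum>x\<in>S. \<bar>a x\<bar>)"
    unfolding \<nu>_def pairing_dirac_sum[OF R] sum_distrib_left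
    by (intro order_trans[OF sum_abs] sum_mono)
  moreover have "\<bar>pairing (\<mu> - \<nu>) R\<bar> \<le> 2 * e"
    using abs_pairing_le[OF R, of "\<mu> - \<nu>"] approx by (simp add: \<nu>_def)
  moreover have "pairing \<mu> R = pairing \<nu> R + pairing (\<mu> - \<nu>) R"
    by (simp add: pairing_simps_left)
  ultimately have \<mu>R: "pairing \<mu> R \<le> 2 * l * (\<Sum>x\<in>S. \<bar>a x\<bar>) + 2 * e"
    by (simp add: abs_le_iff)
  have "h u = 0" "h v = - l"
    unfolding h_def pu pv using ends length_nonneg by (simp_all add: clip_inside)
  then have "pairing (molecule u v) h = -1"
    using ends(3) unfolding pairing_molecule[OF h] duv by simp
  then have "pairing \<mu> h + 1 \<le> norm (\<mu> - molecule u v)"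
    using pairing_le_norm[OF h, of "\<mu> - molecule u v"] by (simp add: pairing_simps_left)
  then show ?thesis
    using \<mu>h \<mu>R by (simp add: algebra_simps)
qed

end


section \<open>Segments whose interior keeps away from the space\<close>

text \<open>An interval function that is additive and positive on the whole interval is positive on one of
  the two parts cut off by any point, so positivity survives cutting at finitely many points.\<close>

lemma additive_positive_subinterval:
  fixes E :: "real \<Rightarrow> real \<Rightarrow> real"
  assumes "finite P" "a \<le> b" "0 < E a b"
    and additive: "\<And>s t u. a \<le> s \<Longrightarrow> s \<le> t \<Longrightarrow> t \<le> u \<Longrightarrow> u \<le> b \<Longrightarrow> E s u = E s t + E t u"
  obtains s t where "a \<le> s" "s \<le> t" "t \<le> b" "0 < E s t" "P \<inter> {s<..<t} = {}"
proof -
  have "\<exists>s t. a' \<le> s \<and> s \<le> t \<and> t \<le> b' \<and> 0 < E s t \<and> P \<inter> {s<..<t} = {}"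
    if "a \<le> a'" "a' \<le> b'" "b' \<le> b" "0 < E a' b'" for a' b'
    using that
  proof (induction "card (P \<inter> {a'<..<b'})" arbitrary: a' b' rule: less_induct)
    case less
    show ?case
    proof (cases "P \<inter> {a'<..<b'} = {}")
      case True
      then show ?thesis using less.prems by blast
    next
      case False
      then obtain t where t: "t \<in> P" "a' < t" "t < b'"
        by auto
      have "P \<inter> {a'<..<t} \<subset> P \<inter> {a'<..<b'}" "P \<inter> {t<..<b'} \<subset> P \<inter> {a'<..<b'}"
        using t by auto
      then have smaller: "card (P \<inter> {a'<..<t}) < card (P \<inter> {a'<..<b'})"
          "card (P \<inter> {t<..<b'}) < card (P \<inter> {a'<..<b'})"
        using \<open>finite P\<close> by (simp_all add: psubset_card_mono)
      have "E a' b' = E a' t + E t b'"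
        using t less.prems by (intro additive) auto
      then consider "0 < E a' t" | "0 < E t b'"
        using less.prems by linarith
      then show ?thesis
      proof cases
        case 1
        then have "\<exists>s u. a' \<le> s \<and> s \<le> u \<and> u \<le> t \<and> 0 < E s u \<and> P \<inter> {s<..<u} = {}"
          using t less.prems by (intro less.hyps[OF smaller(1)]) auto
        then show ?thesis using t by (meson less_imp_le order_trans)
      next
        case 2
        then have "\<exists>s u. t \<le> s \<and> s \<le> u \<and> u \<le> b' \<and> 0 < E s u \<and> P \<inter> {s<..<u} = {}"
          using t less.prems by (intro less.hyps[OF smaller(2)]) auto
        then show ?thesis using t by (meson less_imp_le order_trans)
      qed
    qed
  qed
  from this[of a b] show ?thesis
    using that assms(2,3) by blast
qed

text \<open>The constant \<open>c\<close> bounds from below the distance of points with different projections to the part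
  of the segment between \<open>a\<^sub>0\<close> and \<open>b\<^sub>0\<close>. It turns uniform bounds for functions of the projection into
  Lipschitz bounds.\<close>

locale gap_segment = tree_segment \<iota> \<gamma> l p
  for \<iota> :: "'m::{metric_space,zero} \<Rightarrow> 't::metric_space" and \<gamma> l p +
  fixes a\<^sub>0 b\<^sub>0 c :: real
  assumes gap_order: "0 \<le> a\<^sub>0" "a\<^sub>0 \<le> b\<^sub>0" "b\<^sub>0 \<le> l" and gap_pos: "0 < c"
    and gap: "clip a\<^sub>0 b\<^sub>0 (p x) \<noteq> clip a\<^sub>0 b\<^sub>0 (p y) \<Longrightarrow> c \<le> dist x y"
begin

lemma gap_sub:
  assumes "a\<^sub>0 \<le> a" "a \<le> b" "b \<le> b\<^sub>0" "clip a b (p x) \<noteq> clip a b (p y)"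
  shows "c \<le> dist x y"
  using assms clip_clip[OF assms(1-3)] by (intro gap) metis

lemma mono_lipschitz:
  assumes ab: "a\<^sub>0 \<le> a" "a \<le> b" "b \<le> b\<^sub>0" and r: "mono_on {a..b} r"
  shows "((r b - r a) / c)-lipschitz_on UNIV (\<lambda>x. r (clip a b (p x)))"
proof -
  have osc: "r a \<le> r b"
    using ab r by (intro mono_onD[OF r]) auto
  have "r (clip a b (p x)) - r (clip a b (p y)) \<le> (r b - r a) / c * dist x y" for x y
  proof (cases "clip a b (p x) = clip a b (p y)")
    case True
    then show ?thesis using osc gap_pos by simp
  next
    case False
    have "r (clip a b (p x)) \<le> r b" "r a \<le> r (clip a b (p y))"
      using ab clip_range[OF ab(2)] by (auto intro!: mono_onD[OF r])
    then have "r (clip a b (p x)) - r (clip a b (p y)) \<le> (r b - r a) / c * c"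
      using gap_pos by simp
    also have "\<dots> \<le> (r b - r a) / c * dist x y"
      using gap_sub[OF ab False] osc gap_pos by (intro mult_left_mono) auto
    finally show ?thesis .
  qed
  then show ?thesis
    using osc gap_pos by (simp add: lipschitz_real_iff)
qed

text \<open>Replace \<open>\<mu>\<close> by a finitely supported \<open>\<nu>\<close>. The excess of the pairing of \<open>\<nu>\<close> with \<open>r\<close> over a multiple of
  the increase of \<open>r\<close> is an additive interval function, so it is positive on some interval without
  feet of the support of \<open>\<nu>\<close> in its interior. There \<open>\<nu>\<close> has constant mass on the far side,
  which is large enough to survive the return to \<open>\<mu>\<close>.\<close>

lemma positive_subsegment:
  assumes r: "mono_on {a\<^sub>0..b\<^sub>0} r" and pos: "0 < pairing \<mu> (\<lambda>x. r (clip a\<^sub>0 b\<^sub>0 (p x)))"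
  obtains a b \<kappa> where "a\<^sub>0 \<le> a" "a < b" "b \<le> b\<^sub>0" "0 < \<kappa>"
    and "\<And>s t. a \<le> s \<Longrightarrow> s \<le> t \<Longrightarrow> t \<le> b \<Longrightarrow> \<kappa> * (t - s) \<le> pairing \<mu> (\<lambda>x. clip s t (p x))"
proof -
  define A where "A = pairing \<mu> (\<lambda>x. r (clip a\<^sub>0 b\<^sub>0 (p x)))"
  define w where "w = r b\<^sub>0 - r a\<^sub>0"
  have w: "0 \<le> w"
    using gap_order r by (auto simp: w_def intro!: mono_onD[OF r])
  \<comment> \<open>The approximation costs at most \<open>\<kappa>\<close> per unit of increase: once for \<open>r\<close> itself and once for the
    coordinate. Starting with an excess over \<open>2 * \<kappa>\<close> leaves \<open>\<kappa>\<close>, and \<open>3 * \<kappa> * w < A\<close> suffices for that.\<close>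
  define \<kappa> where "\<kappa> = A / (4 * (w + 1))"
  have \<kappa>: "0 < \<kappa>" "0 < \<kappa> * c"
    using pos w gap_pos by (auto simp: \<kappa>_def A_def)
  have "A = \<kappa> * (4 * (w + 1))"
    using w by (simp add: \<kappa>_def)
  then have "A = 4 * (\<kappa> * w) + 4 * \<kappa>"
    by (simp add: algebra_simps)
  moreover have "0 \<le> \<kappa> * w"
    using \<kappa> w by simp
  ultimately have "3 * (\<kappa> * w) < A"
    using \<kappa>(1) by linarith
  obtain S m where S: "finite S" "norm (\<mu> - (\<Sum>x\<in>S. m x *\<^sub>R dirac x)) < \<kappa> * c"
    using finite_support_approx[OF \<kappa>(2)] by blast
  define \<nu> where "\<nu> = (\<Sum>x\<in>S. m x *\<^sub>R dirac x)"
  have close: "\<bar>pairing \<mu> (\<lambda>x. f (clip s t (p x))) - pairing \<nu> (\<lambda>x. f (clip s t (p x)))\<bar>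
      \<le> \<kappa> * (f t - f s)"
    if st: "a\<^sub>0 \<le> s" "s \<le> t" "t \<le> b\<^sub>0" and f: "mono_on {s..t} f" for s t f
  proof -
    note lip = mono_lipschitz[OF st f]
    have "\<bar>pairing (\<mu> - \<nu>) (\<lambda>x. f (clip s t (p x)))\<bar> \<le> norm (\<mu> - \<nu>) * ((f t - f s) / c)"
      by (rule abs_pairing_le[OF lip])
    also have "\<dots> \<le> \<kappa> * c * ((f t - f s) / c)"
      using S(2) lipschitz_on_nonneg[OF lip] by (intro mult_right_mono) (auto simp: \<nu>_def)
    finally show ?thesis
      using gap_pos by (simp add: pairing_simps_left)
  qed
  have r_sub: "mono_on {s..t} r" if "a\<^sub>0 \<le> s" "t \<le> b\<^sub>0" for s t
    using r that by (auto intro: mono_on_subset)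
  define E where "E s t = pairing \<nu> (\<lambda>x. r (clip s t (p x))) - 2 * \<kappa> * (r t - r s)" for s t
  have "0 < E a\<^sub>0 b\<^sub>0"
    using close[OF order_refl gap_order(2) order_refl r] \<open>3 * (\<kappa> * w) < A\<close>
    by (simp add: E_def A_def w_def abs_le_iff)
  moreover have "E s u = E s t + E t u" if "a\<^sub>0 \<le> s" "s \<le> t" "t \<le> u" "u \<le> b\<^sub>0" for s t u
  proof -
    have "pairing \<nu> (\<lambda>x. r (clip s t (p x)) + r (clip t u (p x)))
        = pairing \<nu> (\<lambda>x. r (clip s t (p x))) + pairing \<nu> (\<lambda>x. r (clip t u (p x)))"
      using that by (intro pairing_add[OF mono_lipschitz mono_lipschitz] r_sub) auto
    moreover have "pairing \<nu> (\<lambda>x. r (clip s t (p x)) + r (clip t u (p x)))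
        = pairing \<nu> (\<lambda>x. r (clip s u (p x)))"
      using that by (intro pairing_cong_const[where c = "r t"]) (auto simp: clip_def max_def min_def)
    ultimately show ?thesis
      by (simp add: E_def algebra_simps)
  qed
  moreover have "finite (p ` insert 0 S)"
    using S(1) by simp
  ultimately obtain a b where ab: "a\<^sub>0 \<le> a" "a \<le> b" "b \<le> b\<^sub>0" "0 < E a b"
      "p ` insert 0 S \<inter> {a<..<b} = {}"
    using additive_positive_subinterval[OF _ gap_order(2), of _ E] by metis
  \<comment> \<open>No point of the support projects into the interior of this piece, so the finitely supported
    element has constant mass on the far side of its points.\<close>
  define B where "B = (\<Sum>x\<in>S. m x * (of_bool (b \<le> p x) - of_bool (b \<le> p 0)))"
  have piece: "pairing \<nu> (\<lambda>x. f (clip s t (p x))) = B * (f t - f s)"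
    if st: "a \<le> s" "s \<le> t" "t \<le> b" and f: "mono_on {s..t} f" and "s < t" for s t f
  proof -
    have lip: "((f t - f s) / c)-lipschitz_on UNIV (\<lambda>x. f (clip s t (p x)))"
      using st ab f by (intro mono_lipschitz) auto
    have val: "f (clip s t (p x)) = f s + of_bool (b \<le> p x) * (f t - f s)" if "x \<in> insert 0 S" for x
    proof -
      have "p x \<le> a \<or> b \<le> p x"
        using ab(5) that by fastforce
      then show ?thesis
        using st \<open>s < t\<close> ab by (auto simp: clip_below clip_above)
    qed
    have "m x * (f (clip s t (p x)) - f (clip s t (p 0)))
        = m x * (of_bool (b \<le> p x) - of_bool (b \<le> p 0)) * (f t - f s)" if "x \<in> S" for x
      unfolding val[OF insertI2[OF that]] val[OF insertI1] by algebra
    then show ?thesis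
      unfolding \<nu>_def pairing_dirac_sum[OF lip] B_def sum_distrib_right by (rule sum.cong[OF refl])
  qed
  have "E a a = 0"
    by (simp add: E_def clip_def max_absorb1 pairing_const)
  then have "a < b"
    using ab by (cases "a = b") auto
  have "r a \<le> r b"
    using ab by (intro mono_onD[OF r]) auto
  have "0 < (B - 2 * \<kappa>) * (r b - r a)"
    using ab(4) piece[OF order_refl ab(2) order_refl r_sub \<open>a < b\<close>] ab
    by (simp add: E_def algebra_simps)
  then have B: "2 * \<kappa> < B"
    using \<open>r a \<le> r b\<close> by (simp add: zero_less_mult_iff)
  show ?thesis
  proof (rule that[OF ab(1) \<open>a < b\<close> ab(3) \<kappa>(1)])
    fix s t assume st: "a \<le> s" "s \<le> t" "t \<le> b"
    have id: "mono_on {s..t} (\<lambda>u::real. u)"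
      by (simp add: mono_on_def)
    have "2 * \<kappa> * (t - s) \<le> pairing \<nu> (\<lambda>x. clip s t (p x))"
    proof (cases "s = t")
      case True
      then have "clip s t u = t" for u
        by (simp add: clip_def max_absorb1)
      then show ?thesis
        by (simp add: True pairing_const)
    next
      case False
      then show ?thesis
        using piece[OF st id] B st by (simp add: mult_right_mono)
    qed
    then show "\<kappa> * (t - s) \<le> pairing \<mu> (\<lambda>x. clip s t (p x))"
      using close[OF _ st(2) _ id] st ab by (auto simp: abs_le_iff algebra_simps)
  qed
qed

text \<open>If the slope of \<open>\<phi>\<close> along the molecule is close to \<open>-1\<close>, then so it is on the part of the segment
  which the molecule covers. Since \<open>\<mu>\<close> is positive there, turning the slope to \<open>1\<close> on this part
  increases the pairing with \<open>\<mu>\<close>, up to an error that is small because the space has a gap there.\<close>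

lemma crossing_molecule_estimate:
  assumes \<mu>: "norm \<mu> \<le> 1" and ab: "a\<^sub>0 \<le> a" "a \<le> b" "b \<le> b\<^sub>0" and "0 < \<kappa>" "0 < q"
    and positive: "\<And>s t. a \<le> s \<Longrightarrow> s \<le> t \<Longrightarrow> t \<le> b \<Longrightarrow> \<kappa> * (t - s) \<le> pairing \<mu> (\<lambda>x. clip s t (p x))"
    and "u \<noteq> v" and crossing: "q * dist u v \<le> clip a b (p v) - clip a b (p u)"
    and \<phi>: "1-lipschitz_on UNIV \<phi>"
  shows "pairing \<mu> \<phi> - (\<phi> v - \<phi> u) / dist u v \<le> 2 - \<kappa> * q * c"
proof -
  obtain H where H: "1-lipschitz_on UNIV H" "\<And>x. H (\<iota> x) = \<phi> x"
    using lipschitz_extension_exists[OF dist_embed \<phi>] by blast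
  define D s t where "D = dist u v" and "s = clip a b (p u)" and "t = clip a b (p v)"
  define e where "e = 1 + (\<phi> v - \<phi> u) / D"
  define r where "r x = H (\<gamma> x) + x" for x
  have D: "0 < D"
    using \<open>u \<noteq> v\<close> by (simp add: D_def)
  have "0 < q * D"
    using D \<open>0 < q\<close> by simp
  then have "s < t" and ts: "q * D \<le> t - s"
    using crossing by (simp_all add: D_def s_def t_def)
  have st: "a \<le> s" "s \<le> t" "t \<le> b" and st0: "a\<^sub>0 \<le> s" "t \<le> b\<^sub>0" and stl: "0 \<le> s" "t \<le> l"
    using \<open>s < t\<close> clip_range(1)[OF ab(2), of "p u"] clip_range(2)[OF ab(2), of "p v"] ab gap_order
    unfolding s_def t_def by linarith+
  have cD: "c \<le> D"
    unfolding D_def using \<open>s < t\<close> by (intro gap_sub[OF ab]) (simp add: s_def t_def)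
  have \<phi>_uv: "\<phi> v - \<phi> u = e * D - D"
    using D by (simp add: e_def distrib_right)
  have "\<phi> u - \<phi> v \<le> D"
    using \<phi> by (simp add: lipschitz_real_iff D_def)
  then have "0 \<le> e * D"
    using \<phi>_uv by linarith
  then have e: "0 \<le> e"
    using D by (simp add: zero_le_mult_iff)
  have "D = dist (\<iota> u) (\<gamma> s) + (t - s) + dist (\<gamma> t) (\<iota> v)"
    using dist_through_clip[of a b u v] ab gap_order \<open>s < t\<close> by (simp add: D_def s_def t_def)
  moreover have "H (\<iota> u) - H (\<gamma> s) \<le> dist (\<iota> u) (\<gamma> s)" "H (\<gamma> t) - H (\<iota> v) \<le> dist (\<gamma> t) (\<iota> v)"
    using H(1) by (simp_all add: lipschitz_real_iff)
  ultimately have rise: "r t - r s \<le> e * D"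
    using \<phi>_uv by (simp add: r_def H(2))
  have mono: "mono_on {s..t} r"
    unfolding r_def by (rule rising_along_segment[OF H(1) stl])
  note along = along_segment_lipschitz[OF stl(1) st(2) stl(2) H(1)]
    and slope = clip_lipschitz[OF stl(1) st(2) stl(2)]
  have "pairing \<mu> (\<lambda>x. H (\<iota> x) - H (\<gamma> (clip s t (p x))) + 1 * clip s t (p x)) \<le> 1"
    using pairing_le_norm[OF reslope_lipschitz[OF stl(1) st(2) stl(2) H(1), of 1]] \<mu>
    by (rule order_trans) simp
  then have "pairing \<mu> \<phi> - pairing \<mu> (\<lambda>x. H (\<gamma> (clip s t (p x)))) + pairing \<mu> (\<lambda>x. clip s t (p x)) \<le> 1"
    using pairing_reslope[OF stl(1) st(2) stl(2) H(1), of 1 \<mu>] by (simp add: H(2))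
  moreover have "pairing \<mu> (\<lambda>x. r (clip s t (p x)))
      = pairing \<mu> (\<lambda>x. H (\<gamma> (clip s t (p x)))) + pairing \<mu> (\<lambda>x. clip s t (p x))"
    unfolding r_def by (rule pairing_add[OF along slope])
  moreover have "pairing \<mu> (\<lambda>x. r (clip s t (p x))) \<le> e * D / c"
  proof -
    have "pairing \<mu> (\<lambda>x. r (clip s t (p x))) \<le> norm \<mu> * ((r t - r s) / c)"
      using abs_pairing_le[OF mono_lipschitz[OF st0(1) st(2) st0(2) mono], of \<mu>] by simp
    also have "\<dots> \<le> 1 * ((r t - r s) / c)"
      using \<mu> lipschitz_on_nonneg[OF mono_lipschitz[OF st0(1) st(2) st0(2) mono]]
      by (intro mult_right_mono)
    also have "\<dots> \<le> e * D / c"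
      using rise gap_pos by (simp add: divide_right_mono)
    finally show ?thesis .
  qed
  moreover have "\<kappa> * (q * D) \<le> pairing \<mu> (\<lambda>x. clip s t (p x))"
    using positive[OF st] mult_left_mono[OF ts less_imp_le[OF \<open>0 < \<kappa>\<close>]] by linarith
  ultimately have \<mu>\<phi>: "pairing \<mu> \<phi> \<le> 1 + e * D / c - 2 * (\<kappa> * (q * D))"
    by simp
  have "pairing \<mu> \<phi> - e \<le> 1 - \<kappa> * q * c"
  proof (cases "\<kappa> * q * c \<le> e")
    case True
    then show ?thesis
      using pairing_le_norm[OF \<phi>, of \<mu>] \<mu> by simp
  next
    case False
    then have "e * D \<le> \<kappa> * q * c * D"
      using D by (intro mult_right_mono) auto
    then have "e * D / c \<le> \<kappa> * (q * D)"
      using gap_pos by (simp add: divide_le_eq mult_ac)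
    moreover have "\<kappa> * q * c \<le> \<kappa> * (q * D)"
      using cD \<open>0 < \<kappa>\<close> \<open>0 < q\<close> by (simp add: mult.assoc)
    ultimately show ?thesis
      using \<mu>\<phi> e by linarith
  qed
  moreover have "(\<phi> v - \<phi> u) / dist u v = e - 1"
    by (simp add: e_def D_def)
  ultimately show ?thesis
    by simp
qed

end

section \<open>Slices and molecules\<close>

text \<open>The unit ball is the closed convex hull of the molecules, so a uniform bound on the molecules of a
  larger slice passes to the slice. The convex combinations can be avoided: for each \<open>\<phi>\<close> the function
  \<open>t * g - \<phi>\<close> with \<open>t = d / (1 - c')\<close> has its Lipschitz constant bounded on molecules, whether \<open>g\<close> is
  steep on them or not, and pairing it with \<open>\<nu>\<close> gives the estimate.\<close>

lemma slice_bound_from_molecules: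
  assumes \<mu>: "norm \<mu> \<le> 1" and g: "1-lipschitz_on UNIV g" and c: "0 \<le> c'" "c' < c" "c' < 1" and "0 < d"
    and molecules: "\<And>u v \<phi>. u \<noteq> v \<Longrightarrow> 1-lipschitz_on UNIV \<phi> \<Longrightarrow> c' * dist u v < g v - g u \<Longrightarrow>
      pairing \<mu> \<phi> - (\<phi> v - \<phi> u) / dist u v \<le> 2 - d"
    and \<nu>: "norm \<nu> \<le> 1" "c < pairing \<nu> g"
  shows "norm (\<mu> - \<nu>) \<le> 2 - d / (1 - c') * (c - c')"
proof (rule lipfree_norm_le)
  fix \<phi> :: "'a \<Rightarrow> real" assume \<phi>: "1-lipschitz_on UNIV \<phi>"
  define t where "t = d / (1 - c')"
  \<comment> \<open>On molecules where \<open>g\<close> has slope at most \<open>c'\<close> the bound \<open>B\<close> follows from \<open>1 + t * c' \<le> B\<close>; on the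
    others \<open>t\<close> is chosen so that \<open>t + (2 - d - pairing \<mu> \<phi>) = B\<close>.\<close>
  define B where "B = 2 - pairing \<mu> \<phi> + t * c'"
  have t: "0 < t" "t * (1 - c') = d"
    using c \<open>0 < d\<close> by (auto simp: t_def)
  have "pairing \<mu> \<phi> \<le> 1"
    using pairing_le_norm[OF \<phi>, of \<mu>] \<mu> by simp
  moreover have "0 \<le> t * c'"
    using t c by simp
  ultimately have B: "1 + t * c' \<le> B" "0 \<le> B"
    unfolding B_def by linarith+
  have "(t * g v - \<phi> v) - (t * g u - \<phi> u) \<le> B * dist v u" for u v
  proof (cases "u = v")
    case False
    then have D: "0 < dist u v" by simp
    show ?thesis
    proof (cases "c' * dist u v < g v - g u")
      case True
      have B_eq: "B = t + (2 - d - pairing \<mu> \<phi>)"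
        unfolding B_def t(2)[symmetric] by (simp add: right_diff_distrib)
      have "g v - g u \<le> dist u v"
        using lipschitz_onD[OF g, of u v] by (simp add: dist_real_def abs_le_iff)
      then have "t * (g v - g u) \<le> t * dist u v"
        using t by simp
      moreover have "- (\<phi> v - \<phi> u) \<le> (2 - d - pairing \<mu> \<phi>) * dist u v"
      proof -
        have "- (\<phi> v - \<phi> u) / dist u v \<le> 2 - d - pairing \<mu> \<phi>"
          using molecules[OF False \<phi> True] unfolding minus_divide_left[symmetric] by linarith
        then show ?thesis
          using D by (simp only: divide_le_eq if_True)
      qed
      moreover have "B * dist u v = t * dist u v + (2 - d - pairing \<mu> \<phi>) * dist u v"
        unfolding B_eq by (rule distrib_right)
      ultimately show ?thesis
        unfolding dist_commute[of v u] right_diff_distrib by linarith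
    next
      case False
      then have "t * (g v - g u) \<le> t * (c' * dist u v)"
        using t by simp
      moreover have "- (\<phi> v - \<phi> u) \<le> dist u v"
        using lipschitz_onD[OF \<phi>, of u v] by (simp add: dist_real_def abs_le_iff)
      moreover have "t * (c' * dist u v) + dist u v = (1 + t * c') * dist u v"
        by (simp add: algebra_simps)
      moreover have "(1 + t * c') * dist u v \<le> B * dist u v"
        using B by (intro mult_right_mono) auto
      ultimately show ?thesis
        unfolding dist_commute[of v u] right_diff_distrib by linarith
    qed
  qed simp
  then have lip: "B-lipschitz_on UNIV (\<lambda>x. t * g x - \<phi> x)"
    using B by (simp add: lipschitz_real_iff)
  have "pairing \<nu> (\<lambda>x. t * g x - \<phi> x) = t * pairing \<nu> g - pairing \<nu> \<phi>"
    unfolding pairing_diff[OF lipschitz_on_cmult_real[OF g] \<phi>] pairing_cmult[OF g] by (rule refl)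
  moreover have "pairing \<nu> (\<lambda>x. t * g x - \<phi> x) \<le> B"
  proof -
    have "pairing \<nu> (\<lambda>x. t * g x - \<phi> x) \<le> norm \<nu> * B"
      using abs_pairing_le[OF lip, of \<nu>] by simp
    also have "\<dots> \<le> 1 * B"
      using \<nu>(1) B by (intro mult_right_mono)
    finally show ?thesis by simp
  qed
  moreover have "t * c \<le> t * pairing \<nu> g"
    using t \<nu>(2) by simp
  ultimately have "pairing \<mu> \<phi> - pairing \<nu> \<phi> \<le> 2 + t * c' - t * c"
    by (simp add: B_def)
  then show "pairing (\<mu> - \<nu>) \<phi> \<le> 2 - d / (1 - c') * (c - c')"
    by (simp add: pairing_simps_left t_def[symmetric] right_diff_distrib)
qed

lemma bdd_above_functional_cball:
  fixes f :: "'b::real_normed_vector \<Rightarrow>\<^sub>L real"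
  shows "bdd_above (blinfun_apply f ` cball 0 1)"
proof (rule bdd_aboveI2)
  fix z :: 'b assume "z \<in> cball 0 1"
  then have "norm f * norm z \<le> norm f"
    by (simp add: mult_left_le)
  then show "blinfun_apply f z \<le> norm f"
    using norm_blinfun[of f z] by simp
qed

lemma not_delta_pointI:
  assumes \<mu>: "norm \<mu> = 1" "c < pairing \<mu> \<phi>" and lip: "L-lipschitz_on UNIV \<phi>" and "0 < d"
    and bound: "\<And>\<nu>. norm \<nu> \<le> 1 \<Longrightarrow> c < pairing \<nu> \<phi> \<Longrightarrow> norm (\<mu> - \<nu>) \<le> 2 - d"
  shows "\<not> delta_point \<mu>"
proof
  assume delta: "delta_point \<mu>"
  obtain f where f: "\<And>\<nu>. blinfun_apply f \<nu> = pairing \<nu> \<phi>"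
    using pairing_functional_exists[OF lip] by blast
  define s where "s = (SUP z\<in>cball 0 1. blinfun_apply f z)"
  have "c < s"
    using \<mu> cSUP_upper[OF _ bdd_above_functional_cball, of \<mu> f] by (simp add: s_def f)
  moreover have slice: "slice f (s - c) = {\<nu>. norm \<nu> \<le> 1 \<and> c < pairing \<nu> \<phi>}"
    unfolding slice_def s_def[symmetric] by (auto simp: f)
  ultimately have "0 < s - c" "\<mu> \<in> slice f (s - c)"
    using \<mu> by auto
  then have "(SUP y\<in>slice f (s - c). norm (\<mu> - y)) = 2"
    using delta unfolding delta_point_def by blast
  moreover have "(SUP y\<in>slice f (s - c). norm (\<mu> - y)) \<le> 2 - d"
    unfolding slice using \<mu> bound by (intro cSUP_least) (auto intro: exI[of _ \<mu>])
  ultimately show False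
    using \<open>0 < d\<close> by simp
qed

lemma not_daugavet_pointD:
  fixes \<mu> :: "'m::{metric_space,zero} lipfree"
  assumes \<mu>: "norm \<mu> = 1" and "\<not> daugavet_point \<mu>"
  obtains F L c d u v where "L-lipschitz_on UNIV F" "0 < d" "c * dist u v < F v - F u"
    and "\<And>u v. u \<noteq> v \<Longrightarrow> c * dist u v < F v - F u \<Longrightarrow> norm (\<mu> - molecule u v) \<le> 2 - d"
proof -
  obtain f \<alpha> where f: "0 < \<alpha>" "(SUP y\<in>slice f \<alpha>. norm (\<mu> - y)) \<noteq> 2"
    using assms unfolding daugavet_point_def by auto
  define F where "F x = blinfun_apply f (dirac x)" for x
  define s where "s = (SUP z\<in>cball 0 1. blinfun_apply f z)"
  define c where "c = s - \<alpha>"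
  have F: "(norm f)-lipschitz_on UNIV F" "\<And>\<nu>. blinfun_apply f \<nu> = pairing \<nu> F"
    unfolding F_def[abs_def] by (rule functional_eq_pairing)+
  have slice: "slice f \<alpha> = {\<nu>. norm \<nu> \<le> 1 \<and> c < pairing \<nu> F}"
    unfolding slice_def s_def[symmetric] c_def by (auto simp: F)
  have le2: "norm (\<mu> - y) \<le> 2" if "y \<in> slice f \<alpha>" for y
    using norm_triangle_ineq4[of \<mu> y] that \<mu> by (simp add: slice)
  then have bdd: "bdd_above ((\<lambda>y. norm (\<mu> - y)) ` slice f \<alpha>)"
    by (rule bdd_aboveI2)
  have "c < s"
    using f by (simp add: c_def)
  then obtain z where "z \<in> cball 0 1" "c < blinfun_apply f z"
    unfolding s_def using less_cSUP_iff[OF _ bdd_above_functional_cball, of c f] by auto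
  then have "slice f \<alpha> \<noteq> {}"
    by (auto simp: slice F)
  then have "(SUP y\<in>slice f \<alpha>. norm (\<mu> - y)) \<le> 2"
    by (rule cSUP_least) (rule le2)
  define d where "d = 2 - (SUP y\<in>slice f \<alpha>. norm (\<mu> - y))"
  have "0 < d"
    using f \<open>_ \<le> 2\<close> by (simp add: d_def)
  moreover have "norm (\<mu> - molecule u v) \<le> 2 - d" if "u \<noteq> v" "c * dist u v < F v - F u" for u v
  proof -
    have "molecule u v \<in> slice f \<alpha>"
      using that by (simp add: slice norm_molecule_le pairing_molecule[OF F(1)] less_divide_eq)
    then show ?thesis
      using cSUP_upper[OF _ bdd] by (simp add: d_def)
  qed
  moreover have "\<exists>u v. c * dist u v < F v - F u"
  proof (rule ccontr)
    assume "\<not> ?thesis"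
    then have flat: "F v - F u \<le> c * dist u v" for u v
      by (simp add: not_less)
    have "0 \<le> c"
    proof (rule ccontr)
      assume "\<not> 0 \<le> c"
      have "u = v" for u v :: 'm
      proof -
        have "0 \<le> c * dist u v"
          using flat[of u v] flat[of v u] by (simp add: dist_commute)
        then show ?thesis
          using \<open>\<not> 0 \<le> c\<close> by (simp add: zero_le_mult_iff)
      qed
      then have "0-lipschitz_on UNIV \<phi>" for \<phi> :: "'m \<Rightarrow> real"
        unfolding lipschitz_real_iff by (metis diff_self mult_zero_left order_refl)
      then have "\<bar>pairing \<mu> \<phi>\<bar> \<le> norm \<mu> * 0" for \<phi>
        by (rule abs_pairing_le)
      then have "norm \<mu> \<le> 0"
        by (intro lipfree_norm_le) simp
      then show False
        using \<mu> by simp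
    qed
    then have lip: "c-lipschitz_on UNIV F"
      using flat by (simp add: lipschitz_real_iff dist_commute)
    have "s \<le> c"
      unfolding s_def
    proof (rule cSUP_least)
      fix z :: "'m lipfree" assume "z \<in> cball 0 1"
      then have "norm z * c \<le> c"
        using \<open>0 \<le> c\<close> by (simp add: mult_left_le_one_le)
      then show "blinfun_apply f z \<le> c"
        using abs_pairing_le[OF lip, of z] by (simp add: F)
    qed simp
    then show False
      using \<open>c < s\<close> by simp
  qed
  ultimately show ?thesis
    using that F(1) by blast
qed

context gap_segment
begin

text \<open>Mixing an almost norming function with the coordinate on a piece of the segment on which \<open>\<mu>\<close> is
  positive gives a slice that contains \<open>\<mu>\<close>, while the molecules of a slightly larger slice spend a fixed
  proportion of their length on this piece.\<close>

lemma not_delta_point_if_positive: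
  assumes \<mu>: "norm \<mu> = 1" and r: "mono_on {a\<^sub>0..b\<^sub>0} r"
    and pos: "0 < pairing \<mu> (\<lambda>x. r (clip a\<^sub>0 b\<^sub>0 (p x)))"
  shows "\<not> delta_point \<mu>"
proof -
  obtain a b \<kappa> where ab: "a\<^sub>0 \<le> a" "a < b" "b \<le> b\<^sub>0" and "0 < \<kappa>"
    and positive: "\<And>s t. a \<le> s \<Longrightarrow> s \<le> t \<Longrightarrow> t \<le> b \<Longrightarrow> \<kappa> * (t - s) \<le> pairing \<mu> (\<lambda>x. clip s t (p x))"
    using positive_subsegment[OF r pos] by metis
  define P where "P = pairing \<mu> (\<lambda>x. clip a b (p x))"
  have slope: "1-lipschitz_on UNIV (\<lambda>x. clip a b (p x))"
    using ab gap_order by (intro clip_lipschitz) auto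
  have "0 < \<kappa> * (b - a)"
    using \<open>0 < \<kappa>\<close> ab by simp
  then have "0 < P"
    using positive[of a b] ab by (simp add: P_def)
  have "P \<le> 1"
    using pairing_le_norm[OF slope, of \<mu>] \<mu> by (simp add: P_def)
  obtain \<phi> where \<phi>: "1-lipschitz_on UNIV \<phi>" "1 - P / 4 < pairing \<mu> \<phi>"
    using almost_norming[of "1 - P / 4" \<mu>] \<mu> \<open>0 < P\<close> by auto
  define g where "g x = 1 / 2 * (\<phi> x + clip a b (p x))" for x
  have g: "1-lipschitz_on UNIV g"
    unfolding g_def using lipschitz_on_cmult_real[OF lipschitz_on_add[OF \<phi>(1) slope], of "1 / 2"] by simp
  have "pairing \<mu> g = 1 / 2 * (pairing \<mu> \<phi> + P)"
    unfolding g_def P_def pairing_cmult[OF lipschitz_on_add[OF \<phi>(1) slope]]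
      pairing_add[OF \<phi>(1) slope] by (rule refl)
  then have \<mu>g: "1 / 2 + 3 * P / 8 < pairing \<mu> g"
    using \<phi>(2) by simp
  \<comment> \<open>To the slope of \<open>g\<close> the function \<open>\<phi>\<close> contributes at most \<open>1 / 2\<close>; any excess comes from the
    coordinate, so a molecule on which \<open>g\<close> has slope above \<open>1 / 2 + P / 8\<close> spends at least
    the proportion \<open>P / 4\<close> of its length on the piece.\<close>
  define d where "d = \<kappa> * (P / 4) * c"
  have "0 < d"
    using \<open>0 < \<kappa>\<close> \<open>0 < P\<close> gap_pos by (simp add: d_def)
  have molecules: "pairing \<mu> \<psi> - (\<psi> v - \<psi> u) / dist u v \<le> 2 - d"
    if uv: "u \<noteq> v" "1-lipschitz_on UNIV \<psi>" "(1 / 2 + P / 8) * dist u v < g v - g u" for u v \<psi>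
    unfolding d_def
  proof (rule crossing_molecule_estimate[OF _ ab(1) less_imp_le[OF ab(2)] ab(3) \<open>0 < \<kappa>\<close> _ positive uv(1) _ uv(2)])
    have "\<phi> v - \<phi> u \<le> dist u v"
      using lipschitz_onD[OF \<phi>(1), of u v] by (simp add: dist_real_def abs_le_iff)
    then show "P / 4 * dist u v \<le> clip a b (p v) - clip a b (p u)"
      using uv(3) by (simp add: g_def algebra_simps)
  qed (use \<mu> \<open>0 < P\<close> in auto)
  define d' where "d' = d / (1 - (1 / 2 + P / 8)) * ((1 / 2 + 3 * P / 8) - (1 / 2 + P / 8))"
  have "0 < d'"
    unfolding d'_def using \<open>0 < d\<close> \<open>0 < P\<close> \<open>P \<le> 1\<close> by (intro mult_pos_pos divide_pos_pos) auto
  show ?thesis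
  proof (rule not_delta_pointI[OF \<mu> \<mu>g g \<open>0 < d'\<close>])
    fix \<nu> :: "'m lipfree"
    assume "norm \<nu> \<le> 1" "1 / 2 + 3 * P / 8 < pairing \<nu> g"
    then show "norm (\<mu> - \<nu>) \<le> 2 - d'"
      unfolding d'_def using \<mu> \<open>0 < P\<close> \<open>P \<le> 1\<close> \<open>0 < d\<close>
      by (intro slice_bound_from_molecules[OF _ g _ _ _ _ molecules]) auto
  qed
qed

end


section \<open>Finding a gap\<close>

lemma tree_segment_exists:
  fixes \<iota> :: "'m::{metric_space,zero} \<Rightarrow> 't::metric_space"
  assumes T: "real_tree T" "range \<iota> \<subseteq> T" and iso: "\<And>x y. dist (\<iota> x) (\<iota> y) = dist x y"
    and \<gamma>: "geodesic_on T \<gamma> l"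
  obtains p where "tree_segment \<iota> \<gamma> l p"
proof -
  obtain p where p: "\<And>z. z \<in> T \<Longrightarrow> p z \<in> {0..l}"
    "\<And>z s. z \<in> T \<Longrightarrow> s \<in> {0..l} \<Longrightarrow> dist z (\<gamma> s) = dist z (\<gamma> (p z)) + \<bar>s - p z\<bar>"
    "\<And>z w. z \<in> T \<Longrightarrow> w \<in> T \<Longrightarrow> p z \<noteq> p w \<Longrightarrow>
      dist z w = dist z (\<gamma> (p z)) + \<bar>p z - p w\<bar> + dist (\<gamma> (p w)) w"
    using real_tree_projection[OF T(1) \<gamma>] by metis
  have \<iota>T: "\<iota> x \<in> T" for x
    using T(2) by auto
  have "tree_segment \<iota> \<gamma> l (\<lambda>x. p (\<iota> x))"
  proof (unfold_locales, goal_cases)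
    case (6 x y)
    then show ?case
      using p(3)[OF \<iota>T \<iota>T 6] iso by metis
  qed (use iso geodesic_onD[OF \<gamma>] p(1,2) \<iota>T in blast)+
  then show ?thesis
    using that by blast
qed

lemma short_molecules_far:
  fixes \<iota> :: "'m::{metric_space,zero} \<Rightarrow> 't::metric_space" and \<mu> :: "'m lipfree"
  assumes T: "real_tree T" "range \<iota> \<subseteq> T" and iso: "\<And>x y. dist (\<iota> x) (\<iota> y) = dist x y"
    and \<mu>: "norm \<mu> = 1" and "0 < d"
  obtains \<eta> where "0 < \<eta>" "\<And>u v. u \<noteq> v \<Longrightarrow> dist u v < \<eta> \<Longrightarrow> 2 - d < norm (\<mu> - molecule u v)"
proof -
  have "0 < d / 8"
    using \<open>0 < d\<close> by simp
  then obtain S a where S: "norm (\<mu> - (\<Sum>x\<in>S. a x *\<^sub>R dirac x)) < d / 8"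
    by (rule finite_support_approx)
  define A where "A = (\<Sum>x\<in>S. \<bar>a x\<bar>)"
  have "0 \<le> A"
    by (simp add: A_def sum_nonneg)
  obtain \<phi> where \<phi>: "1-lipschitz_on UNIV \<phi>" "1 - d / 4 < pairing \<mu> \<phi>"
    using almost_norming[of "1 - d / 4" \<mu>] \<mu> \<open>0 < d\<close> by auto
  show ?thesis
  proof (rule that[of "d / (4 * (A + 1))"])
    show "0 < d / (4 * (A + 1))"
      using \<open>0 < d\<close> \<open>0 \<le> A\<close> by simp
    fix u v :: 'm assume uv: "u \<noteq> v" "dist u v < d / (4 * (A + 1))"
    have "dist u v * (4 * (A + 1)) < d"
      using uv(2) \<open>0 \<le> A\<close> by (simp add: less_divide_eq)
    then have "4 * dist u v + 4 * (dist u v * A) < d"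
      by (simp add: algebra_simps)
    then have small: "2 * dist u v * A \<le> d / 2"
      using zero_le_dist[of u v] unfolding mult.assoc by linarith
    have "\<iota> u \<in> T" "\<iota> v \<in> T"
      using T(2) by auto
    then obtain \<gamma> where \<gamma>: "geodesic_on T \<gamma> (dist u v)" "\<gamma> 0 = \<iota> u" "\<gamma> (dist u v) = \<iota> v"
      using real_tree_geodesic[OF T(1), of "\<iota> u" "\<iota> v"] by (auto simp: iso)
    obtain p where "tree_segment \<iota> \<gamma> (dist u v) p"
      using tree_segment_exists[OF T iso \<gamma>(1)] by blast
    then interpret tree_segment \<iota> \<gamma> "dist u v" p .
    show "2 - d < norm (\<mu> - molecule u v)"
      using short_molecule_estimate[OF \<gamma>(2,3) _ \<phi>(1) less_imp_le[OF S]] uv(1) small \<phi>(2)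
      by (simp add: A_def)
  qed
qed

lemma steep_pair_near_closure:
  fixes H :: "'t::metric_space \<Rightarrow> real" and \<iota> :: "'m \<Rightarrow> 't"
  assumes xy: "x \<in> closure (range \<iota>)" "y \<in> closure (range \<iota>)" and H: "L-lipschitz_on UNIV H"
    and steep: "c * dist x y < H y - H x" and "0 < e"
  obtains u v where "dist (\<iota> u) x < e" "dist (\<iota> v) y < e"
    "c * dist (\<iota> u) (\<iota> v) < H (\<iota> v) - H (\<iota> u)"
proof -
  obtain a b where ab: "\<And>n. a n \<in> range \<iota>" "a \<longlonglongrightarrow> x" "\<And>n. b n \<in> range \<iota>" "b \<longlonglongrightarrow> y"
    using xy unfolding closure_sequential by blast
  have cont: "isCont H z" for z
    using lipschitz_on_continuous_on[OF H] by (simp add: continuous_on_eq_continuous_at)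
  have "(\<lambda>n. H (a n)) \<longlonglongrightarrow> H x" "(\<lambda>n. H (b n)) \<longlonglongrightarrow> H y"
    using ab(2,4) by (auto intro: isCont_tendsto_compose[OF cont])
  then have lim: "(\<lambda>n. H (b n) - H (a n) - c * dist (a n) (b n)) \<longlonglongrightarrow> H y - H x - c * dist x y"
    by (intro tendsto_intros ab(2,4))
  have "0 < H y - H x - c * dist x y"
    using steep by simp
  then have "\<forall>\<^sub>F n in sequentially. 0 < H (b n) - H (a n) - c * dist (a n) (b n)"
    by (rule order_tendstoD(1)[OF lim])
  then have "\<forall>\<^sub>F n in sequentially. 0 < H (b n) - H (a n) - c * dist (a n) (b n)
      \<and> dist (a n) x < e \<and> dist (b n) y < e"
    using tendstoD[OF ab(2) \<open>0 < e\<close>] tendstoD[OF ab(4) \<open>0 < e\<close>] by eventually_elim simp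
  then obtain n where n: "0 < H (b n) - H (a n) - c * dist (a n) (b n)" "dist (a n) x < e" "dist (b n) y < e"
    using eventually_happens'[OF sequentially_bot] by blast
  obtain u v where "a n = \<iota> u" "b n = \<iota> v"
    using ab(1)[of n] ab(3)[of n] by auto
  then show ?thesis
    using that[of u v] n by simp
qed

text \<open>A point of the closure of the space on the segment between two others divides it into two parts,
  one of which is at least as steep as the whole. If no steep pair is short, then a shortest pair of
  the given steepness exists by compactness, and nothing lies between its members. The closure
  provides the compactness, which the space itself may lack.\<close>

lemma steep_gap_exists:
  fixes \<iota> :: "'m::{metric_space,zero} \<Rightarrow> 't::metric_space"
  assumes T: "real_tree T" "range \<iota> \<subseteq> T" and iso: "\<And>x y. dist (\<iota> x) (\<iota> y) = dist x y"
    and H: "L-lipschitz_on UNIV H" and steep: "c * dist u v < H (\<iota> v) - H (\<iota> u)"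
    and "0 < \<eta>" and short: "\<And>u v. u \<noteq> v \<Longrightarrow> dist u v < \<eta> \<Longrightarrow> H (\<iota> v) - H (\<iota> u) \<le> c * dist u v"
  obtains \<gamma> l where "geodesic_on T \<gamma> l" "0 < l"
    and "\<gamma> 0 \<in> closure (range \<iota>)" "\<gamma> l \<in> closure (range \<iota>)"
    and "\<And>s. 0 < s \<Longrightarrow> s < l \<Longrightarrow> \<gamma> s \<notin> closure (range \<iota>)" and "c * l < H (\<gamma> l) - H (\<gamma> 0)"
proof -
  define l where "l = dist u v"
  define \<beta> where "\<beta> = (H (\<iota> v) - H (\<iota> u)) / l"
  have "u \<noteq> v"
    using steep by auto
  moreover have "\<not> dist u v < \<eta>"
    using short[OF \<open>u \<noteq> v\<close>] steep by linarith
  ultimately have "0 < l" "\<eta> \<le> l"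
    by (simp_all add: l_def)
  then have "c < \<beta>"
    using steep by (simp add: \<beta>_def l_def less_divide_eq)
  have "\<iota> u \<in> T" "\<iota> v \<in> T"
    using T(2) by auto
  then obtain \<gamma> where \<gamma>: "geodesic_on T \<gamma> l" "\<gamma> 0 = \<iota> u" "\<gamma> l = \<iota> v"
    using real_tree_geodesic[OF T(1), of "\<iota> u" "\<iota> v"] by (auto simp: iso l_def)
  define C where "C = closure (range \<iota>)"
  have not_short: "\<not> \<beta> * (j - i) \<le> H (\<gamma> j) - H (\<gamma> i)"
    if ij: "i \<in> {0..l}" "j \<in> {0..l}" "i < j" "j - i < \<eta>" "\<gamma> i \<in> C" "\<gamma> j \<in> C" for i j
  proof
    assume *: "\<beta> * (j - i) \<le> H (\<gamma> j) - H (\<gamma> i)"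
    have dij: "dist (\<gamma> i) (\<gamma> j) = j - i"
      using geodesic_onD(3)[OF \<gamma>(1) ij(1,2)] ij(3) by simp
    have "c * (j - i) < \<beta> * (j - i)"
      using \<open>c < \<beta>\<close> ij by simp
    then have steep_ij: "c * dist (\<gamma> i) (\<gamma> j) < H (\<gamma> j) - H (\<gamma> i)"
      using * unfolding dij by linarith
    have room: "0 < (\<eta> - (j - i)) / 2"
      using ij by simp
    obtain u v where uv: "dist (\<iota> u) (\<gamma> i) < (\<eta> - (j - i)) / 2"
        "dist (\<iota> v) (\<gamma> j) < (\<eta> - (j - i)) / 2"
        "c * dist (\<iota> u) (\<iota> v) < H (\<iota> v) - H (\<iota> u)"
      by (rule steep_pair_near_closure[OF ij(5,6)[unfolded C_def] H steep_ij room])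
    have "u \<noteq> v"
      using uv(3) by auto
    have "dist (\<iota> u) (\<iota> v) \<le> dist (\<iota> u) (\<gamma> i) + dist (\<gamma> i) (\<gamma> j) + dist (\<iota> v) (\<gamma> j)"
      using dist_triangle[of "\<iota> u" "\<iota> v" "\<gamma> i"] dist_triangle[of "\<gamma> i" "\<iota> v" "\<gamma> j"]
      by (simp add: dist_commute)
    then have "dist (\<iota> u) (\<iota> v) < \<eta>"
      using uv(1,2) unfolding dij by argo
    then show False
      using short[OF \<open>u \<noteq> v\<close>] uv(3) by (simp add: iso)
  qed
  define Q where "Q = {x \<in> {0..l} \<times> {0..l}. \<gamma> (fst x) \<in> C \<and> \<gamma> (snd x) \<in> C
    \<and> \<eta> \<le> snd x - fst x \<and> \<beta> * (snd x - fst x) \<le> H (\<gamma> (snd x)) - H (\<gamma> (fst x))}"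
  have "compact Q"
  proof -
    have box: "closed ({0..l} \<times> {0..l})"
      by (intro closed_Times closed_real_atLeastAtMost)
    have c\<gamma>: "continuous_on ({0..l} \<times> {0..l}) (\<lambda>x. \<gamma> (fst x))"
        "continuous_on ({0..l} \<times> {0..l}) (\<lambda>x. \<gamma> (snd x))"
      by (auto intro!: continuous_on_compose2[OF geodesic_on_continuous[OF \<gamma>(1)]] continuous_intros)
    have cH: "continuous_on ({0..l} \<times> {0..l}) (\<lambda>x. H (\<gamma> (fst x)))"
        "continuous_on ({0..l} \<times> {0..l}) (\<lambda>x. H (\<gamma> (snd x)))"
      using continuous_on_compose2[OF lipschitz_on_continuous_on[OF H] c\<gamma>(1)]
        continuous_on_compose2[OF lipschitz_on_continuous_on[OF H] c\<gamma>(2)] by auto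
    have Q_eq: "Q = (({0..l} \<times> {0..l}) \<inter> (\<lambda>x. \<gamma> (fst x)) -` C) \<inter> (({0..l} \<times> {0..l}) \<inter> (\<lambda>x. \<gamma> (snd x)) -` C)
        \<inter> {x \<in> {0..l} \<times> {0..l}. \<eta> \<le> snd x - fst x}
        \<inter> {x \<in> {0..l} \<times> {0..l}. \<beta> * (snd x - fst x) \<le> H (\<gamma> (snd x)) - H (\<gamma> (fst x))}"
      by (auto simp: Q_def)
    have "closed Q"
      unfolding Q_eq using box c\<gamma> cH unfolding C_def
      by (intro closed_Int continuous_on_closed_Collect_le continuous_closed_preimage closed_closure
          continuous_intros)
    moreover have "compact ({0..l} \<times> {0..l})"
      by (intro compact_Times compact_Icc)
    ultimately have "compact (({0..l} \<times> {0..l}) \<inter> Q)"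
      by (intro compact_Int_closed)
    moreover have "({0..l} \<times> {0..l}) \<inter> Q = Q"
      by (auto simp: Q_def)
    ultimately show ?thesis
      by simp
  qed
  moreover have "(0, l) \<in> Q"
  proof -
    have "\<iota> u \<in> C" "\<iota> v \<in> C"
      using closure_subset[of "range \<iota>"] unfolding C_def by auto
    then show ?thesis
      using \<gamma> \<open>0 < l\<close> \<open>\<eta> \<le> l\<close> by (simp add: Q_def \<beta>_def)
  qed
  ultimately have "\<exists>x\<in>Q. \<forall>y\<in>Q. snd x - fst x \<le> snd y - fst y"
    by (intro continuous_attains_inf) (auto intro!: continuous_intros)
  then obtain x where x: "x \<in> Q" "\<And>y. y \<in> Q \<Longrightarrow> snd x - fst x \<le> snd y - fst y"
    by blast
  obtain s t where st: "x = (s, t)"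
    by fastforce
  have s: "s \<in> {0..l}" "t \<in> {0..l}" "\<gamma> s \<in> C" "\<gamma> t \<in> C" "\<eta> \<le> t - s" "\<beta> * (t - s) \<le> H (\<gamma> t) - H (\<gamma> s)"
    using x(1) by (auto simp: st Q_def)
  have "s < t"
    using s \<open>0 < \<eta>\<close> by simp
  have empty: "\<gamma> k \<notin> C" if k: "s < k" "k < t" for k
  proof
    assume kC: "\<gamma> k \<in> C"
    have kl: "k \<in> {0..l}"
      using k s by auto
    have "\<beta> * (t - s) = \<beta> * (t - k) + \<beta> * (k - s)"
      by (simp add: algebra_simps)
    then consider "\<beta> * (k - s) \<le> H (\<gamma> k) - H (\<gamma> s)" | "\<beta> * (t - k) \<le> H (\<gamma> t) - H (\<gamma> k)"
      using s(6) by linarith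
    then show False
    proof cases
      case 1
      then have "\<not> k - s < \<eta>"
        using not_short[OF s(1) kl] k s kC by blast
      then have "(s, k) \<in> Q"
        using 1 s kl kC by (simp add: Q_def)
      then show False
        using x(2) k by (fastforce simp: st)
    next
      case 2
      then have "\<not> t - k < \<eta>"
        using not_short[OF kl s(2)] k s kC by blast
      then have "(k, t) \<in> Q"
        using 2 s kl kC by (simp add: Q_def)
      then show False
        using x(2) k by (fastforce simp: st)
    qed
  qed
  show ?thesis
  proof (rule that[of "\<lambda>k. \<gamma> (s + k)" "t - s"])
    show "geodesic_on T (\<lambda>k. \<gamma> (s + k)) (t - s)"
      using \<gamma>(1) s \<open>s < t\<close> unfolding geodesic_on_def by (auto simp: image_subset_iff)
    have "c * (t - s) < \<beta> * (t - s)"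
      using \<open>c < \<beta>\<close> \<open>s < t\<close> by simp
    then show "c * (t - s) < H (\<gamma> (s + (t - s))) - H (\<gamma> (s + 0))"
      using s(6) by simp
  qed (use s \<open>s < t\<close> empty in \<open>auto simp: C_def\<close>)
qed

text \<open>Minus the coordinate on the segment pairs to almost \<open>-1\<close> with the molecule of two points near its
  ends. If this molecule has distance less than \<open>2\<close> from \<open>\<mu>\<close>, then a function with slope \<open>-1\<close> on the
  segment cannot almost norm \<open>\<mu>\<close>, so giving an almost norming \<open>H\<close> this slope must lower its pairing with \<open>\<mu>\<close>.
  The amount is the right-hand side of the estimate.\<close>

lemma (in tree_segment) overlap_with_close_molecule:
  fixes H :: "'t \<Rightarrow> real"
  assumes "0 < \<tau>" "8 * \<tau> \<le> l" and near: "dist (\<iota> u) (\<gamma> 0) \<le> \<tau>" "dist (\<iota> v) (\<gamma> l) \<le> \<tau>"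
    and H: "1-lipschitz_on UNIV H" and close: "norm (\<mu> - molecule u v) \<le> 2 - d"
  shows "pairing \<mu> (\<lambda>x. H (\<iota> x)) - 1 + d - 8 * \<tau> / l
    \<le> pairing \<mu> (\<lambda>x. H (\<gamma> (clip \<tau> (l - \<tau>) (p x))) + clip \<tau> (l - \<tau>) (p x))"
proof -
  have l: "0 \<in> {0..l}" "l \<in> {0..l}" "\<tau> \<in> {0..l}" "l - \<tau> \<in> {0..l}" "0 < l"
    and ab: "0 \<le> \<tau>" "\<tau> \<le> l - \<tau>" "l - \<tau> \<le> l"
    using assms(1,2) by auto
  define h where "h x = H (\<iota> x) - H (\<gamma> (clip \<tau> (l - \<tau>) (p x))) + (-1) * clip \<tau> (l - \<tau>) (p x)" for x
  define D where "D = dist u v"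
  have h: "1-lipschitz_on UNIV h"
    unfolding h_def by (rule reslope_lipschitz[OF ab H]) simp
  have H_diff: "H z - H w \<le> dist z w" for z w
    using lipschitz_onD[OF H, of z w] by (simp add: dist_real_def abs_le_iff)
  have "p u \<le> \<tau>"
    using dist_foot[OF l(1), of u] near(1) zero_le_dist[of "\<iota> u" "\<gamma> (p u)"] by linarith
  then have clip_u: "clip \<tau> (l - \<tau>) (p u) = \<tau>"
    by (rule clip_below)
  have "l - \<tau> \<le> p v"
    using dist_foot[OF l(2), of v] near(2) zero_le_dist[of "\<iota> v" "\<gamma> (p v)"] by linarith
  then have clip_v: "clip \<tau> (l - \<tau>) (p v) = l - \<tau>"
    using ab by (intro clip_above)
  have "dist (\<iota> u) (\<gamma> \<tau>) \<le> 2 * \<tau>"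
    using dist_triangle[of "\<iota> u" "\<gamma> \<tau>" "\<gamma> 0"] dist_on_segment[OF l(1,3)] near(1) \<open>0 < \<tau>\<close> by simp
  moreover have "dist (\<iota> v) (\<gamma> (l - \<tau>)) \<le> 2 * \<tau>"
    using dist_triangle[of "\<iota> v" "\<gamma> (l - \<tau>)" "\<gamma> l"] dist_on_segment[OF l(2,4)] near(2) \<open>0 < \<tau>\<close> by simp
  ultimately have descent: "h v - h u \<le> 6 * \<tau> - l"
    using H_diff[of "\<gamma> \<tau>" "\<iota> u"] H_diff[of "\<iota> v" "\<gamma> (l - \<tau>)"]
    unfolding h_def clip_u clip_v by (simp add: dist_commute)
  have "dist (\<iota> u) (\<iota> v) \<le> dist (\<iota> u) (\<gamma> 0) + dist (\<gamma> 0) (\<gamma> l) + dist (\<iota> v) (\<gamma> l)"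
    using dist_triangle[of "\<iota> u" "\<iota> v" "\<gamma> 0"] dist_triangle[of "\<gamma> 0" "\<iota> v" "\<gamma> l"]
    by (simp add: dist_commute)
  then have D: "D \<le> l + 2 * \<tau>"
    using near dist_on_segment[OF l(1,2)] l(5) by (simp add: D_def dist_embed)
  have "u \<noteq> v"
    using descent assms(1,2) by auto
  then have "0 < D"
    by (simp add: D_def)
  have "(h v - h u) / D \<le> 8 * \<tau> / l - 1"
  proof -
    have "(1 - 8 * \<tau> / l) * D \<le> (1 - 8 * \<tau> / l) * (l + 2 * \<tau>)"
      using D assms(2) l(5) by (intro mult_left_mono) (auto simp: divide_le_eq)
    also have "\<dots> = l - 6 * \<tau> - 16 * \<tau> * (\<tau> / l)"
      using l(5) by (simp add: field_simps)
    also have "\<dots> \<le> l - 6 * \<tau>"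
      using \<open>0 < \<tau>\<close> l(5) by simp
    finally have "h v - h u \<le> (8 * \<tau> / l - 1) * D"
      using descent by (simp add: left_diff_distrib)
    then show ?thesis
      using \<open>0 < D\<close> by (simp add: divide_le_eq)
  qed
  moreover have "pairing \<mu> h - (h v - h u) / D \<le> 2 - d"
    using pairing_le_norm[OF h, of "\<mu> - molecule u v"] close
    by (simp add: pairing_simps_left pairing_molecule[OF h] D_def)
  moreover have "pairing \<mu> h = pairing \<mu> (\<lambda>x. H (\<iota> x))
      - pairing \<mu> (\<lambda>x. H (\<gamma> (clip \<tau> (l - \<tau>) (p x))) + clip \<tau> (l - \<tau>) (p x))"
    using pairing_reslope[OF ab H, of "-1" \<mu>]
      pairing_add[OF along_segment_lipschitz[OF ab H] clip_lipschitz[OF ab], of \<mu>]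
    unfolding h_def by simp
  ultimately show ?thesis
    by linarith
qed

lemma (in tree_segment) gap_segment_interior:
  assumes away: "\<And>s. 0 < s \<Longrightarrow> s < l \<Longrightarrow> \<gamma> s \<notin> closure (range \<iota>)"
    and "0 < \<tau>" "2 * \<tau> < l"
  obtains c where "gap_segment \<iota> \<gamma> l p \<tau> (l - \<tau>) c"
proof -
  have "continuous_on {\<tau>..l - \<tau>} \<gamma>"
    by (rule lipschitz_on_continuous_on[of 1])
      (use \<open>0 < \<tau>\<close> in \<open>auto simp: lipschitz_on_def dist_on_segment dist_real_def\<close>)
  then have "continuous_on {\<tau>..l - \<tau>} (\<lambda>t. infdist (\<gamma> t) (closure (range \<iota>)))"
    by (intro continuous_intros)
  then have "\<exists>s\<in>{\<tau>..l - \<tau>}. \<forall>t\<in>{\<tau>..l - \<tau>}.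
      infdist (\<gamma> s) (closure (range \<iota>)) \<le> infdist (\<gamma> t) (closure (range \<iota>))"
    using assms(3) by (intro continuous_attains_inf) auto
  then obtain s where s: "s \<in> {\<tau>..l - \<tau>}"
      "\<And>t. t \<in> {\<tau>..l - \<tau>} \<Longrightarrow> infdist (\<gamma> s) (closure (range \<iota>)) \<le> infdist (\<gamma> t) (closure (range \<iota>))"
    by blast
  define c\<^sub>1 where "c\<^sub>1 = infdist (\<gamma> s) (closure (range \<iota>))"
  have "0 < c\<^sub>1"
    unfolding c\<^sub>1_def using away[of s] s(1) \<open>0 < \<tau>\<close> by (intro infdist_pos_not_in_closed) auto
  have far: "c\<^sub>1 \<le> dist (\<iota> x) (\<gamma> (p x))" if "\<tau> \<le> p x" "p x \<le> l - \<tau>" for x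
  proof -
    have "\<iota> x \<in> closure (range \<iota>)"
      using closure_subset[of "range \<iota>"] by auto
    then have "infdist (\<gamma> (p x)) (closure (range \<iota>)) \<le> dist (\<gamma> (p x)) (\<iota> x)"
      by (rule infdist_le)
    then show ?thesis
      using s(2)[of "p x"] that by (simp add: c\<^sub>1_def dist_commute)
  qed
  have "gap_segment \<iota> \<gamma> l p \<tau> (l - \<tau>) (min c\<^sub>1 (l - 2 * \<tau>))"
  proof (unfold_locales, goal_cases)
    case (5 x y)
    then have "p x \<noteq> p y"
      by auto
    note through = dist_through[OF this]
    have "c\<^sub>1 \<le> dist (\<iota> x) (\<gamma> (p x)) \<or> c\<^sub>1 \<le> dist (\<gamma> (p y)) (\<iota> y) \<or> l - 2 * \<tau> \<le> \<bar>p x - p y\<bar>"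
      using far[of x] far[of y] 5 unfolding clip_def dist_commute[of "\<gamma> (p y)"] by linarith
    moreover have "0 \<le> dist (\<iota> x) (\<gamma> (p x))" "0 \<le> dist (\<gamma> (p y)) (\<iota> y)"
      by simp_all
    ultimately show ?case
      unfolding through by linarith
  qed (use assms(2,3) \<open>0 < c\<^sub>1\<close> in auto)
  then show ?thesis
    using that by blast
qed

theorem theorem4p6:
  fixes T M :: "'t::metric_space set"
    and \<iota> :: "'m::{metric_space,zero} \<Rightarrow> 't"
    and \<mu> :: "'m lipfree"
  assumes "real_tree T"
    and "M \<subseteq> T"
    \<comment> \<open>the pointed metric space \<open>'m\<close> is the subset \<open>M\<close> with the metric inherited from \<open>T\<close>
      and origin \<open>\<iota> 0\<close>\<close>
    and "bij_betw \<iota> UNIV M"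
    and "\<And>x y. dist x y = dist (\<iota> x) (\<iota> y)"
    and "\<mu> \<in> sphere 0 1"
  shows "daugavet_point \<mu> \<longleftrightarrow> delta_point \<mu>"
proof
  assume "daugavet_point \<mu>"
  then show "delta_point \<mu>"
    by (simp add: daugavet_point_def delta_point_def)
next
  assume delta: "delta_point \<mu>"
  show "daugavet_point \<mu>"
  proof (rule ccontr)
    assume no: "\<not> daugavet_point \<mu>"
    have \<mu>: "norm \<mu> = 1"
      using assms(5) by simp
    have T: "real_tree T" "range \<iota> \<subseteq> T"
      using assms(1-3) by (auto simp: bij_betw_def)
    have iso: "dist (\<iota> x) (\<iota> y) = dist x y" for x y
      using assms(4)[of x y] by simp
    obtain F L c d u v where F: "L-lipschitz_on UNIV F" and "0 < d" and uv: "c * dist u v < F v - F u"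
      and steep: "\<And>u v. u \<noteq> v \<Longrightarrow> c * dist u v < F v - F u \<Longrightarrow> norm (\<mu> - molecule u v) \<le> 2 - d"
      using not_daugavet_pointD[OF \<mu> no] by metis
    obtain K where K: "L-lipschitz_on UNIV K" "\<And>x. K (\<iota> x) = F x"
      using lipschitz_extension_exists[OF iso F] by blast
    obtain \<eta> where "0 < \<eta>"
      and \<eta>: "\<And>u v. u \<noteq> v \<Longrightarrow> dist u v < \<eta> \<Longrightarrow> 2 - d < norm (\<mu> - molecule u v)"
      using short_molecules_far[OF T iso \<mu> \<open>0 < d\<close>] by metis
    have short: "K (\<iota> v) - K (\<iota> u) \<le> c * dist u v" if "u \<noteq> v" "dist u v < \<eta>" for u v
      using \<eta>[OF that] steep[OF that(1)] unfolding K(2) by linarith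
    obtain \<gamma> l where \<gamma>: "geodesic_on T \<gamma> l" "0 < l"
      and ends: "\<gamma> 0 \<in> closure (range \<iota>)" "\<gamma> l \<in> closure (range \<iota>)"
      and away: "\<And>s. 0 < s \<Longrightarrow> s < l \<Longrightarrow> \<gamma> s \<notin> closure (range \<iota>)"
      and steep_gap: "c * l < K (\<gamma> l) - K (\<gamma> 0)"
      using steep_gap_exists[OF T iso K(1) _ \<open>0 < \<eta>\<close> short, of u v] uv unfolding K(2) by metis
    obtain p where "tree_segment \<iota> \<gamma> l p"
      using tree_segment_exists[OF T iso \<gamma>(1)] by blast
    then interpret tree_segment \<iota> \<gamma> l p .
    \<comment> \<open>The cut-off at the ends costs \<open>8 * \<tau> / l\<close>, which is at most \<open>d / 4\<close>.\<close>
    define \<tau> where "\<tau> = l * min d 1 / 32"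
    have \<tau>: "0 < \<tau>" "8 * \<tau> \<le> l" "2 * \<tau> < l" "8 * \<tau> / l \<le> d / 4"
      using \<gamma>(2) \<open>0 < d\<close> by (auto simp: \<tau>_def min_def)
    have "dist (\<gamma> 0) (\<gamma> l) = l"
      using dist_on_segment[of 0 l] \<gamma>(2) by simp
    then obtain x y where xy: "dist (\<iota> x) (\<gamma> 0) < \<tau>" "dist (\<iota> y) (\<gamma> l) < \<tau>"
        "c * dist (\<iota> x) (\<iota> y) < K (\<iota> y) - K (\<iota> x)"
      using steep_pair_near_closure[OF ends K(1) _ \<tau>(1)] steep_gap by metis
    have "x \<noteq> y"
      using xy(3) by auto
    then have close: "norm (\<mu> - molecule x y) \<le> 2 - d"
      using steep[of x y] xy(3) by (simp add: iso K(2))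
    obtain \<phi> where \<phi>: "1-lipschitz_on UNIV \<phi>" "1 - d / 4 < pairing \<mu> \<phi>"
      using almost_norming[of "1 - d / 4" \<mu>] \<mu> \<open>0 < d\<close> by auto
    obtain H where H: "1-lipschitz_on UNIV H" "\<And>x. H (\<iota> x) = \<phi> x"
      using lipschitz_extension_exists[OF iso \<phi>(1)] by blast
    have pos: "0 < pairing \<mu> (\<lambda>x. H (\<gamma> (clip \<tau> (l - \<tau>) (p x))) + clip \<tau> (l - \<tau>) (p x))"
      using overlap_with_close_molecule[OF \<tau>(1,2) less_imp_le[OF xy(1)] less_imp_le[OF xy(2)] H(1) close]
        \<phi>(2) \<tau>(4) \<open>0 < d\<close> unfolding H(2) by linarith
    obtain c' where "gap_segment \<iota> \<gamma> l p \<tau> (l - \<tau>) c'"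
      using gap_segment_interior[OF away \<tau>(1,3)] by blast
    then interpret gap_segment \<iota> \<gamma> l p \<tau> "l - \<tau>" c' .
    have "mono_on {\<tau>..l - \<tau>} (\<lambda>s. H (\<gamma> s) + s)"
      using \<tau> by (intro rising_along_segment[OF H(1)]) auto
    then show False
      using not_delta_point_if_positive[OF \<mu> _ pos] delta by blast
  qed
qed

end
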